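(* Let $f:\mathbb{R}^n\to\mathbb{R}$ be $\mathcal{C}^2$ and let $\bar x$ be a nondegenerate critical point of Morse index $1$ with $f(\bar x)=c$. If $\theta>0$ is sufficiently small, then for every sufficiently small $\epsilon>0$ (depending on $\theta$) the following holds. Let $A$ and $B$ be the two path components of $\{x:f(x)\le c-\epsilon\}\cap\mathring{\mathbb{B}}(\bar x,\theta)$, and consider the problem of minimizing $|x-y|$ over $x\in A$, $y\in B$. Then the global minimizer $(\tilde x,\tilde y)$ of this problem is the only pair with $\tilde x\in A$, $\tilde y\in B$ satisfying the optimality conditions $\nabla f(\tilde x)=\kappa_1(\tilde y-\tilde x)$, $\nabla f(\tilde y)=\kappa_2(\tilde x-\tilde y)$, $f(\tilde x)=f(\tilde y)=c-\epsilon$, for some $\kappa_1,\kappa_2\ge 0$.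
   Context: A critical point $\bar x$ of a $\mathcal{C}^2$ function is nondegenerate if $\nabla^2 f(\bar x)$ is invertible; its Morse index is the number of negative eigenvalues of $\nabla^2 f(\bar x)$. $\mathring{\mathbb{B}}(\bar x,\theta)$ is the open Euclidean ball of radius $\theta$ about $\bar x$. *)

theory Defs
  imports "HOL-Analysis.Analysis" "HOL-Computational_Algebra.Polynomial"
begin

definition charpoly :: "real^'n^'n \<Rightarrow> real poly" where
  "charpoly M = det (\<chi> i j. (if i = j then [:0, 1:] else 0) - [:M $ i $ j:])"

definition morse_index :: "real^'n^'n \<Rightarrow> nat" where
  "morse_index M = (\<Sum>t \<in> {t. t < 0 \<and> poly (charpoly M) t = 0}. order t (charpoly M))"

definition C2_with :: "(real^'n \<Rightarrow> real) \<Rightarrow> (real^'n \<Rightarrow> real^'n) \<Rightarrow> (real^'n \<Rightarrow> real^'n^'n) \<Rightarrow> bool" where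
  "C2_with f g H \<longleftrightarrow> (\<forall>x. GDERIV f x :> g x) \<and>
     (\<forall>x. (g has_derivative (\<lambda>h. H x *v h)) (at x)) \<and> continuous_on UNIV H"

end

theory Submission
  imports Defs
begin

text \<open>
  Let \<open>e\<close> be a unit eigenvector of the Hessian at the saddle \<open>z\<close> for its negative eigenvalue, and
  split \<open>x - z\<close> into its height along \<open>e\<close> and a part orthogonal to \<open>e\<close>. Near \<open>z\<close> the set
  \<open>f < f z\<close> lies in a double cone around the axis \<open>e\<close>, so the sign of the height separates the
  two components, and each of them is star-like enough to be contracted to the axis. Eliminating
  the multipliers from the optimality conditions forces both points into a much thinner cone.
  There two points of equal level differ almost orthogonally to \<open>e\<close>, where the Hessian is
  positive, so the level sets are strictly convex: \<open>g x \<bullet> (x' - x) < 0\<close>. For two optimal pairs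
  with differences \<open>d = y - x\<close> and \<open>d' = y' - x'\<close> this gives \<open>d \<bullet> (d' - d) > 0\<close> and
  \<open>d' \<bullet> (d - d') > 0\<close>, whose sum is the contradiction \<open>- (norm (d' - d))\<^sup>2 > 0\<close>.
\<close>

section \<open>Morse index and the characteristic polynomial\<close>

text \<open>For an exactly quadratic \<open>f\<close> both components are convex and uniqueness is
  immediate. Hence convexity is used only in the thin cone, and the optimality conditions must first
  bring the points into it. These estimates are homogeneous in the height above the saddle, so they
  hold on one ball for every level below \<open>f z\<close>; the size of \<epsilon> matters only for
  the components and for the existence of a minimizer. The constants are chosen in this order:
  \<open>C\<close> from the two curvatures \<mu> and \<nu>, then \<eta> together with a \<delta> of
  order \<eta>, then the radius \<open>r\<close> within which the gradient is \<eta>-close to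
  linear; \<open>r\<close> bounds \<theta>.\<close>

lemma poly_charpoly: "poly (charpoly M) t = det (t *\<^sub>R mat 1 - M)"
  unfolding charpoly_def det_def
  by (simp add: poly_sum poly_prod mat_def) (auto intro!: sum.cong prod.cong)

lemma poly_charpoly_eq_0_iff:
  "poly (charpoly M) t = 0 \<longleftrightarrow> (\<exists>v. v \<noteq> 0 \<and> M *v v = t *\<^sub>R v)"
proof -
  have "poly (charpoly M) t = 0 \<longleftrightarrow> \<not> invertible (t *\<^sub>R mat 1 - M)"
    by (simp add: poly_charpoly invertible_det_nz)
  also have "\<dots> \<longleftrightarrow> (\<exists>v. v \<noteq> 0 \<and> (t *\<^sub>R mat 1 - M) *v v = 0)"
    unfolding invertible_left_inverse matrix_left_invertible_ker by auto
  also have "\<dots> \<longleftrightarrow> (\<exists>v. v \<noteq> 0 \<and> M *v v = t *\<^sub>R v)"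
    by (auto simp: matrix_vector_mult_diff_rdistrib scaleR_matrix_vector_assoc[symmetric])
  finally show ?thesis .
qed

lemma det_const_poly:
  fixes P :: "'a::comm_ring_1^'n^'n"
  shows "det (\<chi> i j. [:P $ i $ j:]) = [:det P:]"
proof -
  have prd: "(\<Prod>i\<in>S. [:c i:]) = [:\<Prod>i\<in>S. c i:]" for S and c :: "'n \<Rightarrow> 'a"
    by (induction S rule: infinite_finite_induct) (auto simp: one_pCons)
  have sm: "(\<Sum>i\<in>S. [:c i:]) = [:\<Sum>i\<in>S. c i:]" for S and c :: "('n \<Rightarrow> 'n) \<Rightarrow> 'a"
    by (induction S rule: infinite_finite_induct) auto
  show ?thesis
    unfolding det_def by (simp add: prd of_int_poly sm mult.commute)
qed

text \<open>The index counts roots with algebraic multiplicity, so eigenvectors have to be turned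
  into factors. In a basis that extends \<open>{e1, e2}\<close>, two columns of the characteristic
  matrix are \<open>X - l1\<close> and \<open>X - l2\<close> times constant vectors, and both
  factors come out of the determinant. This includes the case \<open>l1 = l2\<close>.\<close>

lemma eigenvector_pair_dvd_charpoly:
  fixes M :: "real^'n^'n"
  assumes e1: "M *v e1 = l1 *\<^sub>R e1" and e2: "M *v e2 = l2 *\<^sub>R e2"
    and indep: "independent {e1, e2}" and "e1 \<noteq> e2"
  shows "[:- l1, 1:] * [:- l2, 1:] dvd charpoly M"
proof -
  let ?B = "extend_basis {e1, e2}"
  have B: "{e1, e2} \<subseteq> ?B" "independent ?B" "span ?B = UNIV"
    using extend_basis_superset[OF indep] independent_extend_basis[OF indep]
      span_extend_basis[OF indep] by auto
  have "finite ?B" "card ?B = CARD('n)"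
    using B independent_bound dim_eq_card[of ?B UNIV] by auto
  then obtain h where h: "bij_betw h (UNIV :: 'n set) ?B"
    by (metis finite finite_same_card_bij)
  obtain a b where ab: "h a = e1" "h b = e2"
    using h B(1) by (metis bij_betw_iff_bijections insert_subset)
  have "a \<noteq> b" using ab \<open>e1 \<noteq> e2\<close> by auto
  define P :: "real^'n^'n" where "P = (\<chi> i j. h j $ i)"
  have "columns P = ?B"
    using h by (auto simp: columns_def column_def P_def bij_betw_def)
  then have "\<exists>Q. P ** Q = mat 1"
    unfolding matrix_right_invertible_span_columns
    using B(3) by (simp add: span_vec_eq)
  then have "det P \<noteq> 0"
    using invertible_right_inverse invertible_det_nz by blast
  define N :: "real poly^'n^'n" where "N = (\<chi> i j. (if i = j then [:0, 1:] else 0) - [:M $ i $ j:])"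
  define Pp :: "real poly^'n^'n" where "Pp = (\<chi> i j. [:P $ i $ j:])"
  have sm: "(\<Sum>k\<in>S. [:c k:]) = [:\<Sum>k\<in>S. c k:]" for S and c :: "'n \<Rightarrow> real"
    by (induction S rule: infinite_finite_induct) auto
  have NP: "(N ** Pp) $ i $ j = [:0, 1:] * [:h j $ i:] - [:(M *v h j) $ i:]" for i j
  proof -
    have "(N ** Pp) $ i $ j = (\<Sum>k\<in>UNIV. (if i = k then [:0, 1:] * [:h j $ k:] else 0) - [:M $ i $ k * h j $ k:])"
      by (auto simp: matrix_matrix_mult_def N_def Pp_def P_def algebra_simps intro!: sum.cong)
    also have "\<dots> = [:0, 1:] * [:h j $ i:] - (\<Sum>k\<in>UNIV. [:M $ i $ k * h j $ k:])"
      by (simp add: sum_subtractf sum.delta)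
    finally show ?thesis by (simp add: sm matrix_vector_mult_def)
  qed
  \<comment> \<open>Transposing turns the two columns with a linear factor into rows, the form that
    \<open>det_row_mul\<close> handles.\<close>
  define R where "R = transpose (N ** Pp)"
  define v where "v w = (\<chi> i. [:w $ i:])" for w :: "real^'n"
  have Ra: "R $ a = [:- l1, 1:] *s v e1" and Rb: "R $ b = [:- l2, 1:] *s v e2"
    by (simp_all add: vec_eq_iff R_def transpose_def NP ab e1 e2 v_def)
  have "det R = det (\<chi> i. if i = a then [:- l1, 1:] *s v e1 else R $ i)"
    by (rule arg_cong[where f = det]) (simp add: vec_eq_iff Ra)
  also have "\<dots> = [:- l1, 1:] * det (\<chi> i. if i = a then v e1 else R $ i)"
    by (rule det_row_mul)
  also have "det (\<chi> i. if i = a then v e1 else R $ i) =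
      det (\<chi> i. if i = b then [:- l2, 1:] *s v e2 else (if i = a then v e1 else R $ i))"
    using \<open>a \<noteq> b\<close> by (intro arg_cong[where f = det]) (simp add: vec_eq_iff Rb)
  also have "\<dots> = [:- l2, 1:] * det (\<chi> i. if i = b then v e2 else (if i = a then v e1 else R $ i))"
    by (rule det_row_mul)
  finally have "[:- l1, 1:] * [:- l2, 1:] dvd det R"
    unfolding mult.assoc[symmetric] by (rule dvdI)
  also have "det R = smult (det P) (charpoly M)"
    unfolding R_def det_transpose det_mul Pp_def det_const_poly
    by (simp add: N_def charpoly_def)
  finally show ?thesis
    using \<open>det P \<noteq> 0\<close> by (simp add: dvd_smult_iff)
qed

lemma eigenvector_pair_morse_index:
  fixes M :: "real^'n^'n"
  assumes e1: "M *v e1 = l1 *\<^sub>R e1" and e2: "M *v e2 = l2 *\<^sub>R e2"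
    and indep: "independent {e1, e2}" and "e1 \<noteq> e2"
    and "l1 < 0" "l2 < 0" and nz: "charpoly M \<noteq> 0"
  shows "2 \<le> morse_index M"
proof -
  let ?p = "charpoly M" and ?T = "{t. t < 0 \<and> poly (charpoly M) t = 0}"
  have fin: "finite ?T"
    using poly_roots_finite[OF nz] by (rule rev_finite_subset) auto
  have dvd: "[:- l1, 1:] * [:- l2, 1:] dvd ?p"
    by (rule eigenvector_pair_dvd_charpoly) fact+
  have root: "poly ?p l1 = 0" "poly ?p l2 = 0"
    using dvd unfolding poly_eq_0_iff_dvd by (blast intro: dvd_mult_left dvd_mult_right)+
  show ?thesis
  \<comment> \<open>The index sums over distinct roots: a repeated eigenvalue contributes one
    summand of order at least 2, different ones contribute two summands.\<close>
  proof (cases "l1 = l2")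
    case True
    have "[:- l1, 1:] ^ 2 dvd ?p"
      using dvd True by (simp add: power2_eq_square)
    then have "2 \<le> order l1 ?p"
      using nz order_divides by blast
    also have "\<dots> \<le> morse_index M"
      unfolding morse_index_def using fin root \<open>l1 < 0\<close> by (intro member_le_sum) auto
    finally show ?thesis .
  next
    case False
    have "order l1 ?p \<noteq> 0" "order l2 ?p \<noteq> 0"
      using root nz order_root by auto
    then have "2 \<le> (\<Sum>t\<in>{l1, l2}. order t ?p)"
      using False by simp
    also have "\<dots> \<le> morse_index M"
      unfolding morse_index_def using fin root \<open>l1 < 0\<close> \<open>l2 < 0\<close> by (intro sum_mono2) auto
    finally show ?thesis .
  qed
qed

section \<open>Spectral splitting at a critical point of index 1\<close>

text \<open>Minimizing the Rayleigh quotient over the unit sphere of an invariant subspace yields an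
  eigenvector. The subspace \<open>W\<close> is a parameter because the lemma is applied twice: to
  the whole space and to the complement of the first eigenvector.\<close>

lemma selfadjoint_min_eigenvector:
  fixes L :: "'a::euclidean_space \<Rightarrow> 'a"
  assumes lin: "linear L" and sym: "\<And>x y. L x \<bullet> y = x \<bullet> L y"
    and W: "subspace W" and inv: "\<And>x. x \<in> W \<Longrightarrow> L x \<in> W" and nontriv: "W \<noteq> {0}"
  obtains e l where "e \<in> W" "norm e = 1" "L e = l *\<^sub>R e"
    "\<And>w. w \<in> W \<Longrightarrow> l * (norm w)\<^sup>2 \<le> w \<bullet> L w"
proof -
  interpret linear L by fact
  let ?K = "sphere 0 1 \<inter> W"
  have "compact ?K"
    using closed_subspace[OF W] by (intro compact_Int_closed) auto
  moreover have "?K \<noteq> {}"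
  proof -
    obtain w where "w \<in> W" "w \<noteq> 0"
      using nontriv W subspace_0 by blast
    then have "w /\<^sub>R norm w \<in> ?K"
      using W by (simp add: subspace_scale)
    then show ?thesis by blast
  qed
  moreover have "continuous_on ?K (\<lambda>w. w \<bullet> L w)"
    using lin by (intro continuous_intros linear_continuous_on linear_conv_bounded_linear[THEN iffD1])
  ultimately obtain e where e: "e \<in> ?K" and min: "\<And>w. w \<in> ?K \<Longrightarrow> e \<bullet> L e \<le> w \<bullet> L w"
    using continuous_attains_inf by metis
  define l where "l = e \<bullet> L e"
  have ee: "e \<bullet> e = 1" "e \<in> W" "norm e = 1"
    using e by (auto simp: dot_square_norm)
  have low: "l * (norm w)\<^sup>2 \<le> w \<bullet> L w" if "w \<in> W" for w
  proof (cases "w = 0")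
    case False
    have "l \<le> (w /\<^sub>R norm w) \<bullet> L (w /\<^sub>R norm w)"
      unfolding l_def by (rule min) (use that False W in \<open>simp add: subspace_scale\<close>)
    then show ?thesis
      using False by (simp add: scale power2_eq_square field_simps)
  qed simp
  have "L e = l *\<^sub>R e"
  proof -
    define u where "u = L e - l *\<^sub>R e"
    have "u \<in> W" unfolding u_def using W inv ee by (simp add: subspace_diff subspace_scale)
    have eu: "e \<bullet> L u = u \<bullet> u + l * (e \<bullet> u)"
      using sym[of e u] by (simp add: u_def algebra_simps inner_commute)
    \<comment> \<open>first and second variation of the form at the minimizer, in the direction of the residual\<close>
    have key: "0 \<le> 2 * t * (u \<bullet> u) + t\<^sup>2 * (u \<bullet> L u - l * (u \<bullet> u))" for t
    proof -
      have "l * (norm (e + t *\<^sub>R u))\<^sup>2 \<le> (e + t *\<^sub>R u) \<bullet> L (e + t *\<^sub>R u)"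
        using W ee \<open>u \<in> W\<close> by (intro low) (simp add: subspace_add subspace_scale)
      moreover have "(norm (e + t *\<^sub>R u))\<^sup>2 = 1 + 2 * t * (e \<bullet> u) + t\<^sup>2 * (u \<bullet> u)"
        unfolding power2_norm_eq_inner using ee
        by (simp add: inner_simps inner_commute power2_eq_square algebra_simps)
      moreover have "(e + t *\<^sub>R u) \<bullet> L (e + t *\<^sub>R u)
          = l + 2 * t * (e \<bullet> L u) + t\<^sup>2 * (u \<bullet> L u)"
        using sym[of e u]
        by (simp add: add scale inner_simps inner_commute power2_eq_square algebra_simps l_def)
      ultimately show ?thesis unfolding eu by (simp add: algebra_simps)
    qed
    have "u \<bullet> u \<le> 0"
    proof (rule ccontr)
      assume pos: "\<not> u \<bullet> u \<le> 0"
      define k where "k = \<bar>u \<bullet> L u - l * (u \<bullet> u)\<bar> + 1"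
      have "0 < u \<bullet> u" "0 < k" using pos by (auto simp: k_def)
      \<comment> \<open>With this \<open>t\<close> the quadratic term of \<open>key\<close> cancels
        at most half of the negative linear term.\<close>
      define t where "t = - (u \<bullet> u) / k"
      have "t < 0" using \<open>0 < u \<bullet> u\<close> \<open>0 < k\<close> by (simp add: t_def)
      have "t\<^sup>2 * (u \<bullet> L u - l * (u \<bullet> u)) \<le> t\<^sup>2 * k"
        by (intro mult_left_mono) (auto simp: k_def)
      also have "\<dots> = - t * (u \<bullet> u)"
        using \<open>0 < k\<close> by (simp add: t_def power2_eq_square field_simps)
      finally have "t * (u \<bullet> u) \<ge> 0" using key[of t] by linarith
      then show False using \<open>t < 0\<close> \<open>0 < u \<bullet> u\<close> by (simp add: zero_le_mult_iff)
    qed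
    then have "u = 0" by (metis inner_eq_zero_iff inner_ge_zero order_antisym)
    then show ?thesis by (simp add: u_def)
  qed
  then show ?thesis using that ee low by blast
qed

text \<open>The least eigenvalue is negative since some eigenvalue is. The least one on the
  complement of \<open>e\<close> cannot be negative, as two independent negative eigenvectors make
  the index at least 2, nor zero, as \<open>M\<close> is invertible; so it serves as \<nu>.\<close>

lemma morse_index_1_splitting:
  fixes M :: "real^'n^'n"
  assumes sym: "\<And>x y. (M *v x) \<bullet> y = x \<bullet> (M *v y)"
    and inv: "invertible M" and index: "morse_index M = 1"
  obtains e \<mu> \<nu> where "norm e = 1" "0 < \<mu>" "0 < \<nu>" "M *v e = - \<mu> *\<^sub>R e"
    "\<And>v. e \<bullet> v = 0 \<Longrightarrow> \<nu> * (norm v)\<^sup>2 \<le> v \<bullet> (M *v v)"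
proof -
  let ?p = "charpoly M" and ?T = "{t. t < 0 \<and> poly (charpoly M) t = 0}"
  have T: "(\<Sum>t\<in>?T. order t ?p) = 1"
    using index by (simp add: morse_index_def)
  have nz: "?p \<noteq> 0"
  proof
    assume "?p = 0"
    \<comment> \<open>the index would be a sum over an infinite set, hence 0\<close>
    then have "?T = {..<0}" by auto
    then show False using T infinite_Iio[of "0::real"] by simp
  qed
  have "?T \<noteq> {}" using T by (metis sum.empty zero_neq_one)
  then obtain t x where t: "t < 0" "x \<noteq> 0" "M *v x = t *\<^sub>R x"
    using poly_charpoly_eq_0_iff by blast
  have lin: "linear ((*v) M)" by simp
  obtain e l where e: "norm e = 1" "M *v e = l *\<^sub>R e"
    "\<And>w. l * (norm w)\<^sup>2 \<le> w \<bullet> (M *v w)"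
    by (rule selfadjoint_min_eigenvector[OF lin sym subspace_UNIV])
      (use t in \<open>auto\<close>)
  have "l * (norm x)\<^sup>2 \<le> t * (norm x)\<^sup>2"
    using e(3)[of x] t(3) by (simp add: power2_norm_eq_inner)
  then have "l < 0" using t by simp
  define W where "W = {v. e \<bullet> v = 0}"
  have W: "subspace W" unfolding W_def by (rule subspace_hyperplane)
  have WM: "M *v w \<in> W" if "w \<in> W" for w
    using that sym[of e w] e(2) by (simp add: W_def)
  obtain \<nu> where "0 < \<nu>" "\<And>v. e \<bullet> v = 0 \<Longrightarrow> \<nu> * (norm v)\<^sup>2 \<le> v \<bullet> (M *v v)"
  \<comment> \<open>In dimension one the complement is trivial and any positive \<nu> works.\<close>
  proof (cases "W = {0}")
    case True
    then have "v = 0" if "e \<bullet> v = 0" for v using that by (auto simp: W_def)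
    then show ?thesis using that[of 1] by fastforce
  next
    case False
    obtain e' l' where e': "e' \<in> W" "norm e' = 1" "M *v e' = l' *\<^sub>R e'"
      "\<And>w. w \<in> W \<Longrightarrow> l' * (norm w)\<^sup>2 \<le> w \<bullet> (M *v w)"
      by (rule selfadjoint_min_eigenvector[OF lin sym W WM False]) (assumption, rule that)
    have orth: "e \<bullet> e' = 0" using e'(1) by (simp add: W_def)
    have "e \<noteq> e'" using orth e(1) by auto
    have "independent {e, e'}"
      using orth e(1) e'(2) by (intro pairwise_orthogonal_independent)
        (use \<open>e \<noteq> e'\<close> in \<open>auto simp: pairwise_def orthogonal_def inner_commute\<close>)
    then have "\<not> l' < 0"
      using eigenvector_pair_morse_index[OF e(2) e'(3) _ \<open>e \<noteq> e'\<close> \<open>l < 0\<close> _ nz] index by auto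
    moreover have "l' \<noteq> 0"
    proof
      assume "l' = 0"
      then have "M *v e' = 0" using e'(3) by simp
      then have "e' = 0"
        using inv unfolding invertible_left_inverse matrix_left_invertible_ker by blast
      then show False using e'(2) by simp
    qed
    ultimately show ?thesis using that[of l'] e'(4) by (auto simp: W_def)
  qed
  then show ?thesis using that[of e "- l"] e(1,2) \<open>l < 0\<close> by auto
qed

section \<open>Gradients close to a linear map\<close>

text \<open>Closeness is a Lipschitz bound for \<open>g - L\<close>, not just a bound at
  \<open>z\<close>. This permits second-order expansions with the fixed form \<open>L\<close> around
  every point of the ball.\<close>

locale gradient_approx =
  fixes f :: "'a::euclidean_space \<Rightarrow> real" and g L :: "'a \<Rightarrow> 'a" and z :: 'a and r \<eta> :: real
  assumes lin: "bounded_linear L"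
    and grad: "\<And>x. GDERIV f x :> g x"
    and close: "\<And>x y. x \<in> ball z r \<Longrightarrow> y \<in> ball z r \<Longrightarrow>
      norm (g x - g y - L (x - y)) \<le> \<eta> * norm (x - y)"
begin

lemma taylor_upper:
  assumes x: "x \<in> ball z r" and y: "x + d \<in> ball z r"
  shows "f (x + d) \<le> f x + g x \<bullet> d + (d \<bullet> L d + \<eta> * (norm d)\<^sup>2) / 2"
proof -
  interpret L: bounded_linear L by (rule lin)
  let ?q = "d \<bullet> L d + \<eta> * (norm d)\<^sup>2"
  \<comment> \<open>\<open>h\<close> is \<open>f\<close> along the segment minus its proposed
    quadratic majorant, up to the constant \<open>f x\<close>. The slope of \<open>f\<close>
    deviates from the model by at most \<open>t * \<eta> * (norm d)\<^sup>2\<close>, which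
    integrates to the term with \<open>t\<^sup>2 / 2\<close>.\<close>
  define h where "h t = f (x + t *\<^sub>R d) - t * (g x \<bullet> d) - t\<^sup>2 / 2 * ?q" for t
  have "(h has_real_derivative g (x + t *\<^sub>R d) \<bullet> d - g x \<bullet> d - t * ?q) (at t)" for t
  proof -
    have "((\<lambda>t. x + t *\<^sub>R d) has_derivative (\<lambda>s. s *\<^sub>R d)) (at t)"
      by (auto intro!: derivative_eq_intros)
    then have "((\<lambda>t. f (x + t *\<^sub>R d)) has_derivative (\<lambda>s. (s *\<^sub>R d) \<bullet> g (x + t *\<^sub>R d))) (at t)"
      by (rule has_derivative_compose) (use grad in \<open>simp add: gderiv_def\<close>)
    then have "((\<lambda>t. f (x + t *\<^sub>R d)) has_real_derivative g (x + t *\<^sub>R d) \<bullet> d) (at t)"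
      by (simp add: has_field_derivative_def inner_commute mult_commute_abs)
    then show ?thesis unfolding h_def by (auto intro!: derivative_eq_intros)
  qed
  moreover have "g (x + t *\<^sub>R d) \<bullet> d - g x \<bullet> d - t * ?q \<le> 0" if "0 \<le> t" "t \<le> 1" for t
  proof -
    have "x + t *\<^sub>R d = (1 - t) *\<^sub>R x + t *\<^sub>R (x + d)" by (simp add: algebra_simps)
    then have in_ball: "x + t *\<^sub>R d \<in> ball z r"
      using convexD[OF convex_ball x y, of "1 - t" t] that by simp
    have "(g (x + t *\<^sub>R d) - g x - t *\<^sub>R L d) \<bullet> d \<le> norm (g (x + t *\<^sub>R d) - g x - t *\<^sub>R L d) * norm d"
      by (rule norm_cauchy_schwarz)
    also have "\<dots> \<le> (\<eta> * norm (t *\<^sub>R d)) * norm d"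
      using close[OF in_ball x] by (intro mult_right_mono) (auto simp: L.scaleR)
    also have "\<dots> = t * (\<eta> * (norm d)\<^sup>2)"
      using that by (simp add: power2_eq_square)
    finally show ?thesis
      by (simp add: inner_diff_left inner_commute algebra_simps)
  qed
  ultimately have "h 1 \<le> h 0"
    by (intro DERIV_nonpos_imp_nonincreasing[of 0 1 h]) (simp, blast)
  then show ?thesis by (simp add: h_def)
qed

lemma taylor_lower:
  assumes x: "x \<in> ball z r" and y: "x + d \<in> ball z r"
  shows "f x + g x \<bullet> d + (d \<bullet> L d - \<eta> * (norm d)\<^sup>2) / 2 \<le> f (x + d)"
proof -
  interpret neg: gradient_approx "\<lambda>x. - f x" "\<lambda>x. - g x" "\<lambda>x. - L x" z r \<eta>
  proof (rule gradient_approx.intro)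
    show "bounded_linear (\<lambda>x. - L x)" by (rule bounded_linear_minus[OF lin])
    show "GDERIV (\<lambda>x. - f x) x :> - g x" for x by (rule GDERIV_minus[OF grad])
    show "norm (- g x - - g y - - L (x - y)) \<le> \<eta> * norm (x - y)"
      if "x \<in> ball z r" "y \<in> ball z r" for x y
    proof -
      have "- g x - - g y - - L (x - y) = - (g x - g y - L (x - y))" by simp
      then show ?thesis using close[OF that] by (metis norm_minus_cancel)
    qed
  qed
  show ?thesis using neg.taylor_upper[OF x y] by (simp add: diff_divide_distrib add_divide_distrib)
qed

end

text \<open>The second difference of \<open>f\<close> over a parallelogram, expanded along either side.\<close>
lemma gradient_approx_selfadjoint:
  fixes f :: "'a::euclidean_space \<Rightarrow> real"
  assumes approx: "\<And>\<eta>. 0 < \<eta> \<Longrightarrow> \<exists>r>0. gradient_approx f g L z r \<eta>"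
  shows "L x \<bullet> y = x \<bullet> L y"
proof -
  have half: "t\<^sup>2 * (L a \<bullet> b - L b \<bullet> a) \<le> \<eta> * t\<^sup>2 * (norm a + norm b)\<^sup>2"
    if ga: "gradient_approx f g L z r \<eta>" and t: "0 < t" "t * (norm a + norm b) < r"
    for a b r t \<eta>
  proof -
    interpret gradient_approx f g L z r \<eta> by fact
    interpret L: bounded_linear L by (rule lin)
    define a' where "a' = t *\<^sub>R a"
    define b' where "b' = t *\<^sub>R b"
    have na: "norm a' = t * norm a" "norm b' = t * norm b" using t by (auto simp: a'_def b'_def)
    have ab: "norm (a' + b') < r" using t norm_triangle_ineq[of a' b'] na by (simp add: algebra_simps)
    have "t * norm a \<ge> 0" "t * norm b \<ge> 0" using t by auto
    moreover have "t * norm a + t * norm b < r" using t(2) by (simp add: distrib_left)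
    ultimately have ab': "norm a' < r" "norm b' < r" "0 < r"
      unfolding na by linarith+
    have bd: "z + d \<in> ball z r \<longleftrightarrow> norm d < r" for d by (simp add: dist_norm)
    have B: "z \<in> ball z r" "z + a' \<in> ball z r" "z + b' \<in> ball z r"
      "z + a' + b' \<in> ball z r" "z + b' + a' \<in> ball z r"
      using ab ab' ab[unfolded add.commute[of a' b']]
      by (simp_all only: add.assoc bd centre_in_ball)
    have cs: "\<bar>u \<bullet> w\<bar> \<le> \<eta> * k * norm w" if "norm u \<le> \<eta> * k" for u w :: 'a and k
      using Cauchy_Schwarz_ineq2[of u w] mult_right_mono[OF that norm_ge_zero[of w]] by linarith
    have c1: "\<bar>(g (z + a') - g z - L a') \<bullet> b'\<bar> \<le> \<eta> * norm a' * norm b'"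
      using close[OF B(2,1)] by (intro cs) (simp only: add_diff_cancel_left')
    have c2: "\<bar>(g (z + b') - g z - L b') \<bullet> a'\<bar> \<le> \<eta> * norm b' * norm a'"
      using close[OF B(3,1)] by (intro cs) (simp only: add_diff_cancel_left')
    have T: "f z + g z \<bullet> a' + (a' \<bullet> L a' - \<eta> * (norm a')\<^sup>2) / 2 \<le> f (z + a')"
      "f (z + b') \<le> f z + g z \<bullet> b' + (b' \<bullet> L b' + \<eta> * (norm b')\<^sup>2) / 2"
      "f (z + a') + g (z + a') \<bullet> b' + (b' \<bullet> L b' - \<eta> * (norm b')\<^sup>2) / 2 \<le> f (z + a' + b')"
      "f (z + b' + a') \<le> f (z + b') + g (z + b') \<bullet> a' + (a' \<bullet> L a' + \<eta> * (norm a')\<^sup>2) / 2"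
      by (intro taylor_lower taylor_upper B)+
    have sw: "z + b' + a' = z + a' + b'" "\<eta> * norm b' * norm a' = \<eta> * norm a' * norm b'"
      by (simp_all only: ac_simps)
    have "L a' \<bullet> b' - L b' \<bullet> a' \<le> \<eta> * (norm a')\<^sup>2 + \<eta> * (norm b')\<^sup>2 + 2 * (\<eta> * norm a' * norm b')"
      using abs_le_D2[OF c1] abs_le_D1[OF c2] T unfolding sw inner_diff_left add_divide_distrib diff_divide_distrib by linarith
    also have "\<dots> = \<eta> * t\<^sup>2 * (norm a + norm b)\<^sup>2"
      unfolding na by (simp add: power2_eq_square algebra_simps)
    finally show ?thesis by (simp add: a'_def b'_def L.scaleR power2_eq_square algebra_simps)
  qed
  have "L a \<bullet> b - L b \<bullet> a \<le> 0" for a b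
  proof (rule field_le_epsilon)
    fix e :: real assume "0 < e"
    \<comment> \<open>The summand 1 covers \<open>a = b = 0\<close>. Both sides of
      \<open>half\<close> scale with \<open>t\<^sup>2\<close>, so \<open>t\<close> only has to keep
      the parallelogram inside the ball.\<close>
    define \<eta> where "\<eta> = e / ((norm a + norm b)\<^sup>2 + 1)"
    have pos: "0 < (norm a + norm b)\<^sup>2 + 1" by (smt (verit) zero_le_power2)
    have "0 < \<eta>" using \<open>0 < e\<close> pos by (simp add: \<eta>_def)
    then obtain r where r: "0 < r" "gradient_approx f g L z r \<eta>" using approx by blast
    define t where "t = r / (norm a + norm b + 1)"
    have den: "0 < norm a + norm b + 1" by (smt (verit) norm_ge_zero)
    have t: "0 < t" "t * (norm a + norm b) < r"
      using r(1) den by (auto simp: t_def field_simps)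
    have "t\<^sup>2 * (L a \<bullet> b - L b \<bullet> a) \<le> t\<^sup>2 * (\<eta> * (norm a + norm b)\<^sup>2)"
      using half[OF r(2) t] by (simp only: mult_ac)
    then have "L a \<bullet> b - L b \<bullet> a \<le> \<eta> * (norm a + norm b)\<^sup>2"
      using t(1) by (simp only: mult_le_cancel_left_pos zero_less_power)
    also have "\<dots> \<le> \<eta> * ((norm a + norm b)\<^sup>2 + 1)"
      using \<open>0 < \<eta>\<close> by (simp add: algebra_simps)
    also have "\<dots> = e" using pos by (simp add: \<eta>_def)
    finally show "L a \<bullet> b - L b \<bullet> a \<le> 0 + e" by simp
  qed
  from this[of x y] this[of y x] show ?thesis by (simp add: inner_commute)
qed

section \<open>Multiplier rule for a nearest point\<close>

text \<open>The negative sum of the two unit vectors is a descent direction for both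
  \<open>u\<close> and \<open>w\<close>, by strict Cauchy-Schwarz, unless they point in opposite
  directions.\<close>

lemma opposite_if_no_common_descent:
  fixes u w :: "'a::real_inner"
  assumes "u \<noteq> 0" and nodesc: "\<And>d. d \<bullet> u < 0 \<Longrightarrow> \<not> d \<bullet> w < 0"
  obtains k where "0 \<le> k" "w = - k *\<^sub>R u"
proof (cases "w = 0")
  case True
  then show ?thesis using that[of 0] by simp
next
  case False
  define d where "d = - (u /\<^sub>R norm u + w /\<^sub>R norm w)"
  have "norm u *\<^sub>R - w = norm w *\<^sub>R u"
  proof (rule ccontr)
    assume "norm u *\<^sub>R - w \<noteq> norm w *\<^sub>R u"
    then have "u \<bullet> - w \<noteq> norm u * norm (- w)"
      unfolding norm_cauchy_schwarz_eq by auto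
    then have *: "0 < norm u * norm w + u \<bullet> w"
      using norm_cauchy_schwarz[of u "- w"] by simp
    have "d \<bullet> u = - (norm u + (u \<bullet> w) / norm w)" "d \<bullet> w = - (norm w + (u \<bullet> w) / norm u)"
      using assms(1) False
      by (simp_all add: d_def inner_diff_left inner_commute[of w] dot_square_norm power2_eq_square
          divide_inverse mult.commute)
    moreover have "0 < norm u + (u \<bullet> w) / norm w" "0 < norm w + (u \<bullet> w) / norm u"
      using * assms(1) False by (simp_all add: field_simps)
    ultimately show False
      using nodesc[of d] by linarith
  qed
  then have "(1 / norm u) *\<^sub>R (norm u *\<^sub>R - w) = (1 / norm u) *\<^sub>R (norm w *\<^sub>R u)"
    by (rule arg_cong)
  then have "w = - (norm w / norm u) *\<^sub>R u"
    using assms(1) by (simp add: minus_equation_iff[of w])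
  then show ?thesis using that[of "norm w / norm u"] by simp
qed

text \<open>A direction that decreases both \<open>f\<close> and the distance to \<open>y\<close>
  would lead to a nearer admissible point. If \<open>f x < b\<close>, decreasing the distance alone
  would do, and \<open>y - x\<close> does; so the constraint is active.\<close>

lemma nearest_point_multiplier:
  fixes f :: "'a::real_inner \<Rightarrow> real"
  assumes U: "open U" "x \<in> U" and fx: "f x \<le> b" and u: "GDERIV f x :> u" "u \<noteq> 0" and "x \<noteq> y"
    and nearest: "\<And>w. w \<in> U \<Longrightarrow> f w \<le> b \<Longrightarrow> norm (x - y) \<le> norm (w - y)"
  shows "f x = b \<and> (\<exists>\<kappa>\<ge>0. u = \<kappa> *\<^sub>R (y - x))"
proof -
  have nodesc: False if d: "d \<bullet> (x - y) < 0" and fd: "f x < b \<or> d \<bullet> u < 0" for d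
  proof -
    have line: "((\<lambda>t. x + t *\<^sub>R d) \<longlongrightarrow> x) (at_right 0)"
      by (auto intro!: tendsto_eq_intros)
    have ev1: "\<forall>\<^sub>F t in at_right 0. x + t *\<^sub>R d \<in> U"
      using topological_tendstoD[OF line U] .
    have der: "((\<lambda>t. f (x + t *\<^sub>R d)) has_real_derivative d \<bullet> u) (at 0)"
    proof -
      have "((\<lambda>t. x + t *\<^sub>R d) has_derivative (\<lambda>s. s *\<^sub>R d)) (at 0)"
        by (auto intro!: derivative_eq_intros)
      then have "((\<lambda>t. f (x + t *\<^sub>R d)) has_derivative (\<lambda>s. (s *\<^sub>R d) \<bullet> u)) (at 0)"
        by (rule has_derivative_compose) (use u in \<open>simp add: gderiv_def\<close>)
      then show ?thesis
        by (simp add: has_field_derivative_def mult_commute_abs)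
    qed
    have ev2: "\<forall>\<^sub>F t in at_right 0. f (x + t *\<^sub>R d) \<le> b"
    proof (cases "d \<bullet> u < 0")
      case True
      obtain e where "0 < e" "\<And>t. 0 < t \<Longrightarrow> t < e \<Longrightarrow> f (x + t *\<^sub>R d) < f x"
        using DERIV_neg_dec_right[OF der True] by auto
      then show ?thesis
        using fx by (intro eventually_at_rightI[of 0 e]) fastforce+
    next
      case False
      have "((\<lambda>t. f (x + t *\<^sub>R d)) \<longlongrightarrow> f x) (at_right 0)"
        using DERIV_isCont[OF der] by (simp add: isCont_def filterlim_at_split)
      then have "\<forall>\<^sub>F t in at_right 0. f (x + t *\<^sub>R d) < b"
        by (rule order_tendstoD(2)) (use False fd in auto)
      then show ?thesis by eventually_elim simp
    qed
    have ev3: "\<forall>\<^sub>F t in at_right 0. norm (x + t *\<^sub>R d - y) < norm (x - y)"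
    proof -
      have "((\<lambda>t. 2 * (d \<bullet> (x - y)) + t * (d \<bullet> d)) \<longlongrightarrow> 2 * (d \<bullet> (x - y)) + 0 * (d \<bullet> d)) (at_right 0)"
        by (intro tendsto_intros)
      then have "\<forall>\<^sub>F t in at_right 0. 2 * (d \<bullet> (x - y)) + t * (d \<bullet> d) < 0"
        by (rule order_tendstoD(2)) (use d in auto)
      then show ?thesis
        using eventually_at_right_less[of "0::real"]
      proof eventually_elim
        case (elim t)
        have "(norm (x + t *\<^sub>R d - y))\<^sup>2 = (norm (x - y))\<^sup>2 + t * (2 * (d \<bullet> (x - y)) + t * (d \<bullet> d))"
          unfolding power2_norm_eq_inner by (simp add: inner_commute algebra_simps)
        also have "\<dots> < (norm (x - y))\<^sup>2"
          using elim by (simp add: mult_pos_neg)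
        finally show ?case by (simp add: power_less_imp_less_base)
      qed
    qed
    from ev1 ev2 ev3 have "\<forall>\<^sub>F t in at_right (0::real). False"
      by eventually_elim (use nearest in fastforce)
    then show False by (simp add: trivial_limit_at_right_real)
  qed
  have "f x = b"
  proof (rule ccontr)
    assume "f x \<noteq> b"
    moreover have "(y - x) \<bullet> (x - y) < 0"
      using inner_gt_zero_iff[of "x - y"] inner_minus_left[of "x - y" "x - y"] \<open>x \<noteq> y\<close>
      by simp
    ultimately show False
      using nodesc[of "y - x"] fx by simp
  qed
  moreover obtain k where "0 \<le> k" "u = - k *\<^sub>R (x - y)"
    by (rule opposite_if_no_common_descent[of "x - y" u]) (use \<open>x \<noteq> y\<close> nodesc in auto)
  ultimately show ?thesis by (auto intro!: exI[of _ k] simp: algebra_simps)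
qed

section \<open>Sublevel sets near a saddle point\<close>

definition perp :: "'a::real_inner \<Rightarrow> 'a \<Rightarrow> 'a" where
  "perp e p = p - (e \<bullet> p) *\<^sub>R e"

lemma perp_uminus_axis [simp]: "perp (- e) p = perp e p"
  by (simp add: perp_def)

lemma linear_perp: "linear (perp e)"
  by (rule linearI) (simp_all add: perp_def inner_add_right algebra_simps)

context
  fixes e :: "'a::real_inner"
  assumes norm_e: "norm e = 1"
begin

lemma inner_perp: "e \<bullet> perp e p = 0"
  using norm_e by (simp add: perp_def inner_diff_right dot_square_norm)

lemma norm_sq_perp: "(norm p)\<^sup>2 = (e \<bullet> p)\<^sup>2 + (norm (perp e p))\<^sup>2"
proof -
  have "e \<bullet> e = 1" using norm_e by (simp add: dot_square_norm)
  then show ?thesis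
    unfolding power2_norm_eq_inner perp_def
    by (simp add: inner_diff_left inner_diff_right inner_commute[of p e] power2_eq_square)
qed

lemma norm_le_perp: "norm p \<le> \<bar>e \<bullet> p\<bar> + norm (perp e p)"
proof -
  have "norm ((e \<bullet> p) *\<^sub>R e + perp e p) \<le> \<bar>e \<bullet> p\<bar> + norm (perp e p)"
    using norm_triangle_ineq[of "(e \<bullet> p) *\<^sub>R e" "perp e p"] norm_e by simp
  then show ?thesis by (simp add: perp_def)
qed

lemma norm_perp_le: "norm (perp e p) \<le> norm p"
proof -
  have "(norm (perp e p))\<^sup>2 \<le> (norm p)\<^sup>2"
    using norm_sq_perp[of p] zero_le_power2[of "e \<bullet> p"] by linarith
  then show ?thesis by (rule power2_le_imp_le) simp
qed

lemma abs_inner_le_norm: "\<bar>e \<bullet> p\<bar> \<le> norm p"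
  using Cauchy_Schwarz_ineq2[of e p] norm_e by simp

end

text \<open>
  \<open>C\<close> measures the aperture of the cone around the axis \<open>e\<close> that contains the sublevel set,
  \<open>\<delta>\<close> that of the thinner cone that contains the solutions of the optimality conditions.
  The component on the other side of the saddle is treated by replacing \<open>e\<close> with \<open>- e\<close>.
\<close>
locale saddle = gradient_approx f g L z r \<eta>
  for f :: "'a::euclidean_space \<Rightarrow> real" and g L z r \<eta> +
  fixes e :: 'a and \<mu> \<nu> M C \<delta> :: real
  assumes crit: "g z = 0" and norm_e: "norm e = 1" and Le: "L e = - \<mu> *\<^sub>R e"
    and selfadjoint: "\<And>x y. L x \<bullet> y = x \<bullet> L y"
    and coercive: "\<And>v. e \<bullet> v = 0 \<Longrightarrow> \<nu> * (norm v)\<^sup>2 \<le> v \<bullet> L v"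
    and bound: "\<And>v. norm (L v) \<le> M * norm v"
    and pos: "0 < r" "0 < \<mu>" "0 < \<nu>" "0 \<le> M" "0 \<le> \<eta>" "1 \<le> C" "0 \<le> \<delta>" "\<delta> \<le> 1"
    and cone_const: "\<mu> + \<eta> \<le> (C - 1)\<^sup>2 * (\<nu> - \<eta>)"
    and eta_small: "4 * \<eta> \<le> \<nu>" "4 * \<eta> * C\<^sup>2 \<le> \<mu>"
    and delta_large: "\<eta> * (C * (\<mu> + \<eta> * C) + C * \<nu>) \<le> \<nu>\<^sup>2 * \<delta>"
    and delta_small: "4 * (\<nu> + \<mu>) * (M * \<delta> + 3 * \<eta>)\<^sup>2 \<le> \<nu> * \<mu>\<^sup>2"
begin

sublocale L: bounded_linear L by (rule lin)

lemma saddle_uminus: "saddle f g L z r \<eta> (- e) \<mu> \<nu> M C \<delta>"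
proof (intro saddle.intro saddle_axioms.intro gradient_approx_axioms)
  show "norm (- e) = 1" using norm_e by simp
  show "L (- e) = - \<mu> *\<^sub>R - e" by (simp add: L.neg Le)
  show "\<nu> * (norm v)\<^sup>2 \<le> v \<bullet> L v" if "- e \<bullet> v = 0" for v
    using that by (intro coercive) simp
qed (fact crit selfadjoint bound pos cone_const eta_small delta_large delta_small)+

lemma inner_L: "q \<bullet> L p = - \<mu> * (e \<bullet> q) * (e \<bullet> p) + perp e q \<bullet> L (perp e p)"
proof -
  have z: "e \<bullet> perp e p = 0" by (rule inner_perp[OF norm_e])
  have "e \<bullet> L (perp e p) = 0"
    using selfadjoint[of e "perp e p"] z by (simp add: Le)
  then have "((e \<bullet> q) *\<^sub>R e + perp e q) \<bullet> L ((e \<bullet> p) *\<^sub>R e + perp e p)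
      = - \<mu> * (e \<bullet> q) * (e \<bullet> p) + perp e q \<bullet> L (perp e p)"
    using inner_perp[OF norm_e, of q] norm_e
    by (simp add: L.add L.scaleR Le inner_add_left inner_add_right inner_diff_right inner_commute[of _ e] dot_square_norm)
  then show ?thesis by (simp add: perp_def)
qed

text \<open>Coercivity in terms of the full norm: the price is the axial part, which is small for
  vectors almost orthogonal to \<open>e\<close>.\<close>

lemma inner_L_lower: "\<nu> * (norm p)\<^sup>2 - (\<nu> + \<mu>) * (e \<bullet> p)\<^sup>2 \<le> p \<bullet> L p"
  using coercive[OF inner_perp[OF norm_e, of p]] norm_sq_perp[OF norm_e, of p]
  unfolding inner_L[of p p] by (simp add: power2_eq_square algebra_simps)

lemma inner_L_perp_nonneg: "0 \<le> perp e p \<bullet> L (perp e p)"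
proof -
  have "0 \<le> \<nu> * (norm (perp e p))\<^sup>2" using pos by simp
  then show ?thesis using coercive[OF inner_perp[OF norm_e, of p]] by linarith
qed

lemma gradient_inner:
  assumes "x \<in> ball z r"
  shows "\<bar>g x \<bullet> d - L (x - z) \<bullet> d\<bar> \<le> \<eta> * norm (x - z) * norm d"
proof -
  have "norm (g x - L (x - z)) \<le> \<eta> * norm (x - z)"
    using close[OF assms, of z] pos crit by simp
  then have "norm (g x - L (x - z)) * norm d \<le> \<eta> * norm (x - z) * norm d"
    by (rule mult_right_mono) simp
  then show ?thesis
    using Cauchy_Schwarz_ineq2[of "g x - L (x - z)" d] by (simp add: inner_diff_left)
qed

text \<open>Expansion at \<open>z\<close>, where the gradient vanishes, gives
  \<open>p \<bullet> L p \<le> \<eta> * (norm p)\<^sup>2\<close>: the positive part of the form is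
  controlled by the negative one. \<open>C - 1\<close> bounds the slope of \<open>p\<close> against
  the axis; adding the height itself gives \<open>C\<close>.\<close>

lemma sublevel_cone:
  assumes x: "x \<in> ball z r" and "f x \<le> f z"
  shows "norm (x - z) \<le> C * \<bar>e \<bullet> (x - z)\<bar>"
proof -
  define p where "p = x - z"
  define s where "s = e \<bullet> p"
  define a where "a = norm (perp e p)"
  have n: "(norm p)\<^sup>2 = s\<^sup>2 + a\<^sup>2" unfolding s_def a_def by (rule norm_sq_perp[OF norm_e])
  have "f z + g z \<bullet> p + (p \<bullet> L p - \<eta> * (norm p)\<^sup>2) / 2 \<le> f (z + p)"
    by (rule taylor_lower) (use pos x in \<open>auto simp: p_def\<close>)
  moreover have "z + p = x" by (simp add: p_def)
  ultimately have "p \<bullet> L p \<le> \<eta> * (norm p)\<^sup>2"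
    using assms(2) unfolding crit inner_zero_left diff_divide_distrib by simp
  then have "\<nu> * (s\<^sup>2 + a\<^sup>2) - (\<nu> + \<mu>) * s\<^sup>2 \<le> \<eta> * (s\<^sup>2 + a\<^sup>2)"
    using inner_L_lower[of p] unfolding n s_def by linarith
  then have "(\<nu> - \<eta>) * a\<^sup>2 \<le> (\<mu> + \<eta>) * s\<^sup>2"
    by (simp add: algebra_simps)
  also have "\<dots> \<le> ((C - 1)\<^sup>2 * (\<nu> - \<eta>)) * s\<^sup>2"
    by (intro mult_right_mono cone_const) simp
  also have "\<dots> = (\<nu> - \<eta>) * ((C - 1) * \<bar>s\<bar>)\<^sup>2"
    by (simp add: power_mult_distrib)
  finally have "a\<^sup>2 \<le> ((C - 1) * \<bar>s\<bar>)\<^sup>2"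
    using pos eta_small by simp
  then have "a \<le> (C - 1) * \<bar>s\<bar>"
    by (rule power2_le_imp_le) (use pos in simp)
  then show ?thesis
    using norm_le_perp[OF norm_e, of p] unfolding p_def[symmetric] s_def[symmetric] a_def[symmetric]
    by (simp add: algebra_simps)
qed

lemma sublevel_inner_nonzero:
  assumes "x \<in> ball z r" "f x < f z"
  shows "e \<bullet> (x - z) \<noteq> 0"
  using sublevel_cone[of x] assms by auto

lemma four_eta_le: "4 * \<eta> \<le> \<mu>"
proof -
  have "4 * \<eta> * 1 \<le> 4 * \<eta> * C\<^sup>2" using pos by (intro mult_left_mono) auto
  then show ?thesis using eta_small by linarith
qed

text \<open>With \<open>s = 0\<close> the axis point at height \<open>t\<close> is at least
  \<open>\<mu> / 4 * t\<^sup>2\<close> below the saddle value; the thresholds for \<epsilon> come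
  from this.\<close>

lemma axis_antimono:
  assumes "0 \<le> s" "s \<le> t" "t < r"
  shows "f (z + t *\<^sub>R e) \<le> f (z + s *\<^sub>R e) - \<mu> / 4 * (t - s)\<^sup>2"
proof -
  let ?x = "z + s *\<^sub>R e" and ?d = "(t - s) *\<^sub>R e"
  have eq: "?x + ?d = z + t *\<^sub>R e" by (simp add: algebra_simps)
  have ball: "?x \<in> ball z r" "?x + ?d \<in> ball z r"
    unfolding eq using assms norm_e by (auto simp: dist_norm)
  have "f (?x + ?d) \<le> f ?x + g ?x \<bullet> ?d + (?d \<bullet> L ?d + \<eta> * (norm ?d)\<^sup>2) / 2"
    by (rule taylor_upper[OF ball])
  moreover have "?d \<bullet> L ?d = - (\<mu> * (t - s)\<^sup>2)"
    using norm_e by (simp add: L.scaleR Le dot_square_norm power2_eq_square)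
  moreover have nd: "norm ?d = t - s" "norm (?x - z) = s" using norm_e assms by auto
  moreover have "g ?x \<bullet> ?d \<le> 0"
  proof -
    have "g ?x \<bullet> ?d \<le> L (?x - z) \<bullet> ?d + \<eta> * norm (?x - z) * norm ?d"
      using gradient_inner[OF ball(1), of ?d] by linarith
    also have "\<dots> = (\<eta> - \<mu>) * (s * (t - s))"
      unfolding nd using norm_e by (simp add: L.scaleR Le dot_square_norm) (simp add: algebra_simps)
    also have "\<dots> \<le> 0"
      using assms four_eta_le pos by (intro mult_nonpos_nonneg) auto
    finally show ?thesis .
  qed
  moreover have "4 * (\<eta> * (t - s)\<^sup>2) \<le> \<mu> * (t - s)\<^sup>2"
    using mult_right_mono[OF four_eta_le, of "(t - s)\<^sup>2"] by simp
  moreover have "0 \<le> \<mu> * (t - s)\<^sup>2" using pos by simp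
  moreover have "\<mu> / 4 * (t - s)\<^sup>2 = \<mu> * (t - s)\<^sup>2 / 4" by simp
  ultimately show ?thesis unfolding eq nd add_divide_distrib by linarith
qed

text \<open>\<open>d\<close> is the mirror image of \<open>x - z\<close> in the axis, so
  \<open>x + d\<close> is the axis point at twice the height. Reflection makes both parts of
  \<open>L p \<bullet> d\<close> nonpositive, namely \<open>- \<mu> * s\<^sup>2\<close> and
  \<open>- q\<close>. The positive curvature returns at most \<open>q / 2\<close>, and the cone
  bound absorbs the \<eta>-terms into \<open>\<mu> * s\<^sup>2\<close>.\<close>

lemma sublevel_descent:
  assumes x: "x \<in> ball z r" and fx: "f x \<le> f z" and t: "0 \<le> t" "t \<le> 1"
    and s: "s = e \<bullet> (x - z)" and d: "d = s *\<^sub>R e - perp e (x - z)" and y: "x + t *\<^sub>R d \<in> ball z r"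
  shows "f (x + t *\<^sub>R d) \<le> f x"
proof -
  define p where "p = x - z"
  define q where "q = perp e p \<bullet> L (perp e p)"
  have "0 \<le> q" unfolding q_def by (rule inner_L_perp_nonneg)
  have ed: "e \<bullet> d = s" unfolding d using norm_e
    by (simp add: inner_diff_right inner_perp dot_square_norm)
  have pd: "perp e d = - perp e p"
    using ed by (simp add: perp_def[of e d]) (simp add: d p_def)
  have nd: "(norm d)\<^sup>2 = (norm p)\<^sup>2"
    using norm_sq_perp[OF norm_e, of d] norm_sq_perp[OF norm_e, of p] ed pd by (simp add: s p_def)
  have "norm p \<le> C * \<bar>s\<bar>" unfolding p_def s by (rule sublevel_cone[OF x fx])
  then have "(norm p)\<^sup>2 \<le> (C * \<bar>s\<bar>)\<^sup>2" by (rule power_mono) simp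
  then have "4 * \<eta> * (norm p)\<^sup>2 \<le> 4 * \<eta> * C\<^sup>2 * s\<^sup>2"
    using mult_left_mono[of "(norm p)\<^sup>2" "(C * \<bar>s\<bar>)\<^sup>2" "4 * \<eta>"] pos by (simp add: power_mult_distrib)
  also have "\<dots> \<le> \<mu> * s\<^sup>2" by (intro mult_right_mono eta_small) simp
  finally have small: "4 * (\<eta> * (norm p)\<^sup>2) \<le> \<mu> * s\<^sup>2" by simp
  have dLd: "d \<bullet> L d = - \<mu> * s\<^sup>2 + q"
    unfolding inner_L[of d d] ed pd q_def by (simp add: L.neg power2_eq_square)
  have "L p \<bullet> d = - \<mu> * s\<^sup>2 - q"
    unfolding inner_commute[of "L p"] inner_L[of d p] ed pd q_def
    by (simp add: s p_def power2_eq_square)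
  then have gd: "g x \<bullet> d \<le> - \<mu> * s\<^sup>2 - q + \<eta> * (norm p)\<^sup>2"
    using gradient_inner[OF x, of d] power2_eq_imp_eq[OF nd]
    unfolding p_def[symmetric] by (simp add: power2_eq_square)
  have "f (x + t *\<^sub>R d) \<le> f x + g x \<bullet> (t *\<^sub>R d) + ((t *\<^sub>R d) \<bullet> L (t *\<^sub>R d) + \<eta> * (norm (t *\<^sub>R d))\<^sup>2) / 2"
    by (rule taylor_upper[OF x y])
  also have "\<dots> = f x + t * (g x \<bullet> d) + t\<^sup>2 / 2 * (- \<mu> * s\<^sup>2 + q + \<eta> * (norm p)\<^sup>2)"
  proof -
    have "(t *\<^sub>R d) \<bullet> L (t *\<^sub>R d) + \<eta> * (norm (t *\<^sub>R d))\<^sup>2 = t\<^sup>2 * (d \<bullet> L d + \<eta> * (norm d)\<^sup>2)"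
      by (simp add: L.scaleR power_mult_distrib power2_eq_square[of t] algebra_simps)
    then show ?thesis unfolding nd dLd by simp
  qed
  \<comment> \<open>Since \<open>t\<^sup>2 \<le> t\<close>, the second-order part is bounded by a
    term linear in \<open>t\<close>.\<close>
  also have "\<dots> \<le> f x + t * (- \<mu> * s\<^sup>2 - q + \<eta> * (norm p)\<^sup>2) + t / 2 * (q + \<eta> * (norm p)\<^sup>2)"
  proof (intro add_mono mult_left_mono[OF gd] order_refl t)
    have "t\<^sup>2 / 2 * (- \<mu> * s\<^sup>2 + q + \<eta> * (norm p)\<^sup>2) \<le> t\<^sup>2 / 2 * (q + \<eta> * (norm p)\<^sup>2)"
      using pos by (intro mult_left_mono) auto
    also have "\<dots> \<le> t / 2 * (q + \<eta> * (norm p)\<^sup>2)"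
      using t pos \<open>0 \<le> q\<close> mult_left_mono[of t 1 t] by (intro mult_right_mono) (auto simp: power2_eq_square)
    finally show "t\<^sup>2 / 2 * (- \<mu> * s\<^sup>2 + q + \<eta> * (norm p)\<^sup>2) \<le> t / 2 * (q + \<eta> * (norm p)\<^sup>2)" .
  qed
  also have "\<dots> = f x + t * (- \<mu> * s\<^sup>2 - q / 2 + 3 / 2 * (\<eta> * (norm p)\<^sup>2))"
    by (simp add: algebra_simps)
  also have "\<dots> \<le> f x"
  proof -
    have "0 \<le> \<mu> * s\<^sup>2" using pos by simp
    then have "- \<mu> * s\<^sup>2 - q / 2 + 3 / 2 * (\<eta> * (norm p)\<^sup>2) \<le> 0"
      using small \<open>0 \<le> q\<close> by simp
    then show ?thesis using t by (simp add: mult_nonneg_nonpos)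
  qed
  finally show ?thesis .
qed

text \<open>Orthogonally to the axis \<nu> dominates \<eta>, so \<open>f\<close> lies above its
  tangent at the intermediate point. Weighting the tangent bounds at the two ends by
  \<open>1 - t\<close> and \<open>t\<close> cancels the slope.\<close>

lemma perp_convex:
  assumes d: "e \<bullet> d = 0" and x: "x \<in> ball z r" and y: "x + d \<in> ball z r"
    and b: "f x \<le> b" "f (x + d) \<le> b" and t: "0 \<le> t" "t \<le> 1"
  shows "f (x + t *\<^sub>R d) \<le> b"
proof -
  let ?w = "x + t *\<^sub>R d"
  have "?w = (1 - t) *\<^sub>R x + t *\<^sub>R (x + d)" by (simp add: algebra_simps)
  then have w: "?w \<in> ball z r"
    using convexD[OF convex_ball x y, of "1 - t" t] t by simp
  have above: "f ?w + k * (g ?w \<bullet> d) \<le> f (?w + k *\<^sub>R d)" if "?w + k *\<^sub>R d \<in> ball z r" for k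
  proof -
    have "f ?w + g ?w \<bullet> (k *\<^sub>R d) + ((k *\<^sub>R d) \<bullet> L (k *\<^sub>R d) - \<eta> * (norm (k *\<^sub>R d))\<^sup>2) / 2 \<le> f (?w + k *\<^sub>R d)"
      by (rule taylor_lower[OF w that])
    moreover have "\<nu> * (norm (k *\<^sub>R d))\<^sup>2 \<le> (k *\<^sub>R d) \<bullet> L (k *\<^sub>R d)"
      by (rule coercive) (simp add: d)
    moreover have "\<eta> * (norm (k *\<^sub>R d))\<^sup>2 \<le> \<nu> * (norm (k *\<^sub>R d))\<^sup>2"
      using eta_small pos by (intro mult_right_mono) auto
    ultimately show ?thesis unfolding inner_scaleR_right by argo
  qed
  have eqs: "?w + (- t) *\<^sub>R d = x" "?w + (1 - t) *\<^sub>R d = x + d" by (simp_all add: algebra_simps)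
  then have 1: "f ?w - t * (g ?w \<bullet> d) \<le> b" and 2: "f ?w + (1 - t) * (g ?w \<bullet> d) \<le> b"
    using above[of "- t", unfolded eqs, OF x] above[of "1 - t", unfolded eqs, OF y] b by auto
  have "(1 - t) * (f ?w - t * (g ?w \<bullet> d)) + t * (f ?w + (1 - t) * (g ?w \<bullet> d)) \<le> (1 - t) * b + t * b"
    using t by (intro add_mono mult_left_mono 1 2) auto
  then show ?thesis by (simp add: algebra_simps)
qed

text \<open>An explicit description by the sign of the height; \<open>sheets_are_components\<close>
  identifies it, and its mirror image for \<open>- e\<close>, with the path components.\<close>

definition sheet :: "real \<Rightarrow> real \<Rightarrow> 'a set" where
  "sheet \<theta> \<epsilon> = {x \<in> ball z \<theta>. f x \<le> f z - \<epsilon> \<and> 0 < e \<bullet> (x - z)}"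

lemma axis_in_sheet:
  assumes "0 < s" "s < \<theta>" "\<theta> \<le> r" "\<epsilon> \<le> \<mu> / 4 * s\<^sup>2"
  shows "z + s *\<^sub>R e \<in> sheet \<theta> \<epsilon>"
  using axis_antimono[of 0 s] assms norm_e by (auto simp: sheet_def dist_norm dot_square_norm)

lemma path_connected_sheet:
  assumes "\<theta> \<le> r" and eps: "0 < \<epsilon>" "16 * \<epsilon> \<le> \<mu> * \<theta>\<^sup>2"
  shows "path_connected (sheet \<theta> \<epsilon>)"
proof -
  let ?S = "sheet \<theta> \<epsilon>"
  have seg: "path_component ?S x (x + d)" if "\<And>t. 0 \<le> t \<Longrightarrow> t \<le> 1 \<Longrightarrow> x + t *\<^sub>R d \<in> ?S" for x d
  proof (rule path_component_linepath, rule subsetI)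
    fix w assume "w \<in> closed_segment x (x + d)"
    then obtain t where "0 \<le> t" "t \<le> 1" "w = x + t *\<^sub>R d"
      by (auto simp: closed_segment_def algebra_simps)
    then show "w \<in> ?S" using that by simp
  qed
  have in_ball: "x + t *\<^sub>R d \<in> ball z \<theta>" if "x \<in> ball z \<theta>" "x + d \<in> ball z \<theta>" "0 \<le> t" "t \<le> 1" for x d t
  proof -
    have "x + t *\<^sub>R d = (1 - t) *\<^sub>R x + t *\<^sub>R (x + d)" by (simp add: algebra_simps)
    then show ?thesis using convexD[OF convex_ball that(1,2), of "1 - t" t] that by simp
  qed
  have sub: "ball z \<theta> \<subseteq> ball z r" using assms by (simp add: subset_ball)
  have axis: "path_component ?S (z + s *\<^sub>R e) (z + t *\<^sub>R e)"
    if st: "0 < s" "s \<le> t" and mem: "z + s *\<^sub>R e \<in> ?S" "z + t *\<^sub>R e \<in> ?S" for s t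
  proof -
    have "path_component ?S (z + s *\<^sub>R e) (z + s *\<^sub>R e + (t - s) *\<^sub>R e)"
    proof (rule seg)
      fix k :: real assume k: "0 \<le> k" "k \<le> 1"
      define m where "m = s + k * (t - s)"
      have "0 \<le> k * (t - s)" "k * (t - s) \<le> 1 * (t - s)"
        using k st by (simp, intro mult_right_mono) auto
      then have m: "0 < m" "s \<le> m" "m \<le> t" using st by (auto simp: m_def)
      have "t < \<theta>" using mem st norm_e by (auto simp: sheet_def dist_norm)
      have "f (z + m *\<^sub>R e) \<le> f (z + s *\<^sub>R e) - \<mu> / 4 * (m - s)\<^sup>2"
        using m st \<open>t < \<theta>\<close> assms by (intro axis_antimono) auto
      also have "\<dots> \<le> f (z + s *\<^sub>R e)" using pos by simp
      finally have "z + m *\<^sub>R e \<in> ?S"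
        using m mem(1) \<open>t < \<theta>\<close> norm_e by (auto simp: sheet_def dist_norm dot_square_norm)
      then show "z + s *\<^sub>R e + k *\<^sub>R (t - s) *\<^sub>R e \<in> ?S"
        by (simp add: m_def algebra_simps)
    qed
    then show ?thesis by (simp add: algebra_simps)
  qed
  have reach: "\<exists>s>0. path_component ?S x (z + s *\<^sub>R e)" if x: "x \<in> ?S" for x
  proof -
    define s where "s = e \<bullet> (x - z)"
    define a where "a = perp e (x - z)"
    have xa: "x - a = z + s *\<^sub>R e" by (simp add: a_def s_def perp_def)
    have ea: "e \<bullet> a = 0" unfolding a_def by (rule inner_perp[OF norm_e])
    have s: "0 < s" "x \<in> ball z \<theta>" "f x \<le> f z - \<epsilon>" using x by (auto simp: sheet_def s_def)
    show ?thesis \<comment> \<open>The straight path to the axis at the same height can leave the sublevel set when \<open>f x\<close> is close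
      to \<open>f z - \<epsilon>\<close>; aiming at twice the height avoids this unless the target leaves the ball, but then
      the axis point at height \<open>s\<close> is already far below the level.\<close>
    proof (cases "2 * s < \<theta>")
      case True
      define d where "d = s *\<^sub>R e - a"
      have xd: "x + d = z + (2 * s) *\<^sub>R e"
        using xa by (simp add: d_def algebra_simps scaleR_2[symmetric])
      have "x + d \<in> ball z \<theta>" unfolding xd using s True norm_e by (simp add: dist_norm)
      have "path_component ?S x (x + d)"
      proof (rule seg)
        fix t :: real assume t: "0 \<le> t" "t \<le> 1"
        have w: "x + t *\<^sub>R d \<in> ball z \<theta>" by (rule in_ball) fact+
        have "f (x + t *\<^sub>R d) \<le> f x"
          using s w t sub eps by (intro sublevel_descent[where s = s]) (auto simp: s_def d_def a_def)
        moreover have "e \<bullet> (x + t *\<^sub>R d - z) = s + t * s"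
          using ea norm_e by (simp add: d_def s_def inner_add_right inner_diff_right dot_square_norm)
        moreover have "0 \<le> t * s" using t s by simp
        ultimately show "x + t *\<^sub>R d \<in> ?S" using w s by (simp add: sheet_def)
      qed
      then show ?thesis unfolding xd using s by (intro exI[of _ "2 * s"]) simp
    next
      case False
      have "s \<le> norm (x - z)" using abs_inner_le_norm[OF norm_e, of "x - z"] s by (simp add: s_def)
      then have "s < \<theta>" using s by (simp add: dist_norm norm_minus_commute)
      \<comment> \<open>From \<open>s \<ge> \<theta> / 2\<close> the drop
        \<open>\<mu> / 4 * s\<^sup>2\<close> on the axis is at least
        \<open>\<mu> * \<theta>\<^sup>2 / 16\<close>, whence the factor 16 in the assumption on
        \<epsilon>.\<close>
      have "\<theta>\<^sup>2 \<le> (2 * s)\<^sup>2" using False s \<open>s < \<theta>\<close> by (intro power_mono) auto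
      then have "\<mu> * \<theta>\<^sup>2 \<le> \<mu> * (4 * s\<^sup>2)" using pos by (simp add: power_mult_distrib)
      then have "z + s *\<^sub>R e \<in> ?S" using s \<open>s < \<theta>\<close> assms by (intro axis_in_sheet) auto
      then have ends: "x + - a \<in> ball z \<theta>" "f (x + - a) \<le> f z - \<epsilon>"
        using xa by (auto simp: sheet_def)
      have "path_component ?S x (x + - a)"
      proof (rule seg)
        fix t :: real assume t: "0 \<le> t" "t \<le> 1"
        have w: "x + t *\<^sub>R - a \<in> ball z \<theta>" by (rule in_ball) fact+
        have "f (x + t *\<^sub>R - a) \<le> f z - \<epsilon>"
          using s t sub ends ea by (intro perp_convex) auto
        then show "x + t *\<^sub>R - a \<in> ?S"
          using w s ea by (simp add: sheet_def s_def inner_diff_right)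
      qed
      then show ?thesis using xa s by auto
    qed
  qed
  show ?thesis
    unfolding path_connected_component
  proof (intro ballI)
    fix x y assume "x \<in> ?S" "y \<in> ?S"
    then obtain s t where st: "0 < s" "path_component ?S x (z + s *\<^sub>R e)"
      "0 < t" "path_component ?S y (z + t *\<^sub>R e)" using reach by blast
    then have "path_component ?S (z + s *\<^sub>R e) (z + t *\<^sub>R e)"
      using axis[of s t] axis[of t s] path_component_mem(2) path_component_sym
      by (metis linear)
    then show "path_component ?S x y"
      using st path_component_sym path_component_trans by blast
  qed
qed


section \<open>Pairs satisfying the optimality conditions\<close>

text \<open>
  Comparing both endpoints with the midpoint bounds the tilt of the chord: its component along
  \<open>e\<close> is small compared with its length, so the Hessian is positive in its direction.
\<close>
lemma level_chord:
  assumes x: "x \<in> ball z r" and y: "y \<in> ball z r"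
    and sx: "0 < e \<bullet> (x - z)" "norm (perp e (x - z)) \<le> \<delta> * (e \<bullet> (x - z))"
    and sy: "0 < e \<bullet> (y - z)" "norm (perp e (y - z)) \<le> \<delta> * (e \<bullet> (y - z))"
    and "f x = f y" "x \<noteq> y"
  shows "g x \<bullet> (y - x) < 0"
proof -
  define D where "D = y - x"
  define h where "h = (1 / 2) *\<^sub>R D"
  define m where "m = x + h"
  define p where "p = m - z"
  define s where "s = e \<bullet> p"
  have half: "(1 / 2) *\<^sub>R w + (1 / 2) *\<^sub>R w = w" for w :: 'a
    by (simp add: scaleR_left_distrib[symmetric])
  have "m = ((1 / 2) *\<^sub>R x + (1 / 2) *\<^sub>R x) + h" unfolding half m_def ..
  then have mxy: "m = (1 / 2) *\<^sub>R x + (1 / 2) *\<^sub>R y" by (simp add: h_def D_def algebra_simps)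
  have "m + h = (1 / 2) *\<^sub>R y + (1 / 2) *\<^sub>R y" by (simp add: mxy h_def D_def algebra_simps)
  then have D: "x + D = y" "m + h = y" "m + - h = x"
    unfolding half by (simp_all add: D_def m_def)
  have "p = m - ((1 / 2) *\<^sub>R z + (1 / 2) *\<^sub>R z)" unfolding half p_def ..
  then have p: "p = (1 / 2) *\<^sub>R ((x - z) + (y - z))" by (simp add: mxy algebra_simps)
  have m: "m \<in> ball z r"
    unfolding mxy using convexD[OF convex_ball x y, of "1/2" "1/2"] by simp
  have s: "2 * s = e \<bullet> (x - z) + e \<bullet> (y - z)"
    unfolding s_def p by (simp add: inner_add_right)
  have "0 < s" using s sx sy by linarith
  have pp: "norm (perp e p) \<le> \<delta> * s"
  proof -
    have "perp e p = (1 / 2) *\<^sub>R (perp e (x - z) + perp e (y - z))"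
      unfolding p using linear_perp[of e] by (simp only: linear_add linear_cmul)
    then have "2 * norm (perp e p) \<le> norm (perp e (x - z)) + norm (perp e (y - z))"
      using norm_triangle_ineq[of "perp e (x - z)" "perp e (y - z)"] by simp
    also have "\<dots> \<le> \<delta> * (2 * s)" using sx sy unfolding s by (simp add: distrib_left)
    finally show ?thesis by simp
  qed
  have np: "norm p \<le> 2 * s"
  proof -
    have "\<delta> * s \<le> 1 * s" using pos \<open>0 < s\<close> by (intro mult_right_mono) auto
    then show ?thesis
      using norm_le_perp[OF norm_e, of p] pp \<open>0 < s\<close> unfolding s_def[symmetric] by linarith
  qed
  have nw: "norm (w - z) \<le> 2 * (e \<bullet> (w - z))"
    if "0 < e \<bullet> (w - z)" "norm (perp e (w - z)) \<le> \<delta> * (e \<bullet> (w - z))" for w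
  proof -
    have "\<delta> * (e \<bullet> (w - z)) \<le> 1 * (e \<bullet> (w - z))" using pos that by (intro mult_right_mono) auto
    then show ?thesis using norm_le_perp[OF norm_e, of "w - z"] that by linarith
  qed
  have nD: "norm D \<le> 4 * s"
  proof -
    have "norm D \<le> norm (x - z) + norm (y - z)"
      using norm_triangle_ineq4[of "y - z" "x - z"] by (simp add: D_def)
    then show ?thesis using nw[OF sx] nw[OF sy] s by linarith
  qed
  \<comment> \<open>The two half chords share the quadratic term, which cancels because
    \<open>f x = f y\<close>; only \<eta>-errors remain.\<close>
  have mid: "\<bar>g m \<bullet> D\<bar> \<le> \<eta> * s * norm D"
  proof -
    have hh: "g m \<bullet> h = (g m \<bullet> D) / 2" "(norm h)\<^sup>2 = (norm D)\<^sup>2 / 4"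
      by (simp_all add: h_def power_divide)
    have "f m + g m \<bullet> h + (h \<bullet> L h - \<eta> * (norm h)\<^sup>2) / 2 \<le> f y"
      "f y \<le> f m + g m \<bullet> h + (h \<bullet> L h + \<eta> * (norm h)\<^sup>2) / 2"
      "f m - g m \<bullet> h + (h \<bullet> L h - \<eta> * (norm h)\<^sup>2) / 2 \<le> f x"
      "f x \<le> f m - g m \<bullet> h + (h \<bullet> L h + \<eta> * (norm h)\<^sup>2) / 2"
      using taylor_lower[OF m, of h] taylor_upper[OF m, of h]
        taylor_lower[OF m, of "- h"] taylor_upper[OF m, of "- h"] x y
      unfolding D by (simp_all add: L.neg)
    then have "4 * \<bar>g m \<bullet> D\<bar> \<le> \<eta> * (norm D)\<^sup>2"
      using \<open>f x = f y\<close> unfolding hh add_divide_distrib diff_divide_distrib by (simp add: abs_le_iff)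
    also have "\<dots> \<le> \<eta> * (4 * s * norm D)"
      unfolding power2_eq_square using pos nD by (intro mult_left_mono mult_right_mono) auto
    finally show ?thesis by simp
  qed
  \<comment> \<open>In \<open>D \<bullet> L p\<close> the axial part is
    \<open>- \<mu> * (e \<bullet> D) * s\<close>, while the rest is small because \<open>p\<close>
    lies in the thin cone. Every error carries the factor \<open>s\<close>, which divides
    out.\<close>
  have tilt: "\<mu> * \<bar>e \<bullet> D\<bar> \<le> (M * \<delta> + 3 * \<eta>) * norm D"
  proof -
    have "D \<bullet> L p = - \<mu> * (e \<bullet> D) * s + perp e D \<bullet> L (perp e p)"
      unfolding s_def by (rule inner_L)
    moreover have "\<bar>perp e D \<bullet> L (perp e p)\<bar> \<le> norm D * (M * (\<delta> * s))"
    proof -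
      have "\<bar>perp e D \<bullet> L (perp e p)\<bar> \<le> norm (perp e D) * norm (L (perp e p))"
        by (rule Cauchy_Schwarz_ineq2)
      also have "\<dots> \<le> norm D * (M * (\<delta> * s))"
        using norm_perp_le[OF norm_e, of D] order_trans[OF bound mult_left_mono[OF pp pos(4)]]
        by (intro mult_mono) auto
      finally show ?thesis .
    qed
    moreover have "\<bar>g m \<bullet> D - D \<bullet> L p\<bar> \<le> \<eta> * (2 * s) * norm D"
    proof -
      have "\<bar>g m \<bullet> D - D \<bullet> L p\<bar> \<le> \<eta> * norm p * norm D"
        using gradient_inner[OF m, of D] by (simp add: p_def inner_commute)
      also have "\<dots> \<le> \<eta> * (2 * s) * norm D"
        using pos np by (intro mult_right_mono mult_left_mono) auto
      finally show ?thesis .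
    qed
    ultimately have "\<bar>\<mu> * (e \<bullet> D) * s\<bar> \<le> norm D * (M * (\<delta> * s)) + \<eta> * (2 * s) * norm D + \<eta> * s * norm D"
      using mid by (simp only: abs_le_iff minus_mult_left[symmetric]) linarith
    then have "s * (\<mu> * \<bar>e \<bullet> D\<bar>) \<le> s * ((M * \<delta> + 3 * \<eta>) * norm D)"
      using pos \<open>0 < s\<close> by (simp add: abs_mult algebra_simps)
    then show ?thesis using \<open>0 < s\<close> by simp
  qed
  have "0 < norm D" using \<open>x \<noteq> y\<close> by (simp add: D_def)
  \<comment> \<open>The tilt costs at most a quarter of \<open>\<nu> * (norm D)\<^sup>2\<close> and
    \<eta> another quarter, so half of the coercivity survives.\<close>
  have "4 * (\<nu> + \<mu>) * (e \<bullet> D)\<^sup>2 \<le> \<nu> * (norm D)\<^sup>2"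
  proof -
    have "(\<mu> * \<bar>e \<bullet> D\<bar>)\<^sup>2 \<le> ((M * \<delta> + 3 * \<eta>) * norm D)\<^sup>2"
      using tilt pos by (intro power_mono) auto
    then have "4 * (\<nu> + \<mu>) * (\<mu>\<^sup>2 * (e \<bullet> D)\<^sup>2) \<le> 4 * (\<nu> + \<mu>) * ((M * \<delta> + 3 * \<eta>)\<^sup>2 * (norm D)\<^sup>2)"
      using pos by (intro mult_left_mono) (auto simp: power_mult_distrib)
    also have "\<dots> = (4 * (\<nu> + \<mu>) * (M * \<delta> + 3 * \<eta>)\<^sup>2) * (norm D)\<^sup>2" by simp
    also have "\<dots> \<le> (\<nu> * \<mu>\<^sup>2) * (norm D)\<^sup>2"
      by (intro mult_right_mono delta_small) simp
    finally have "\<mu>\<^sup>2 * (4 * (\<nu> + \<mu>) * (e \<bullet> D)\<^sup>2) \<le> \<mu>\<^sup>2 * (\<nu> * (norm D)\<^sup>2)"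
      by (simp add: mult_ac)
    then show ?thesis using pos by (simp only: mult_le_cancel_left_pos zero_less_power)
  qed
  moreover have "4 * (\<eta> * (norm D)\<^sup>2) \<le> \<nu> * (norm D)\<^sup>2"
    using mult_right_mono[OF eta_small(1), of "(norm D)\<^sup>2"] by simp
  moreover have "0 < \<nu> * (norm D)\<^sup>2" using pos \<open>0 < norm D\<close> by simp
  ultimately have "0 < D \<bullet> L D - \<eta> * (norm D)\<^sup>2"
    using inner_L_lower[of D] by linarith
  moreover have "f x + g x \<bullet> D + (D \<bullet> L D - \<eta> * (norm D)\<^sup>2) / 2 \<le> f y"
    using taylor_lower[OF x, of D] y unfolding D by simp
  ultimately show ?thesis using \<open>f x = f y\<close>
    unfolding D_def[symmetric] diff_divide_distrib by linarith
qed

text \<open>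
  With \<open>w\<close> the orthogonal part of \<open>y - x\<close>, the sum of the two conditions tested against \<open>w\<close> has
  \<open>w \<bullet> L w + (k1 + k2) * (w \<bullet> w)\<close> as its main term, so \<open>w\<close> is of the order of the error \<open>\<eta>\<close>.
\<close>
lemma kkt_cone:
  assumes x: "x \<in> ball z r" "f x \<le> f z" "0 < e \<bullet> (x - z)"
    and y: "y \<in> ball z r" "f y \<le> f z" "e \<bullet> (y - z) < 0"
    and k: "0 \<le> k1" "0 \<le> k2" "g x = k1 *\<^sub>R (y - x)" "g y = k2 *\<^sub>R (x - y)"
  shows "norm (perp e (x - z)) \<le> \<delta> * (e \<bullet> (x - z))"
proof -
  define p where "p = x - z"
  define q where "q = y - z"
  define s where "s = e \<bullet> p"
  define u where "u = - (e \<bullet> q)"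
  define a where "a = perp e p"
  define w where "w = perp e (q - p)"
  have su: "0 < s" "0 < u" using x y by (auto simp: s_def u_def p_def q_def)
  have qp: "y - x = q - p" "x - y = - (q - p)" by (simp_all add: p_def q_def)
  have wpq: "w = perp e q - a" unfolding w_def a_def by (simp add: linear_diff[OF linear_perp])
  have ew: "e \<bullet> w = 0" "e \<bullet> a = 0" unfolding w_def a_def by (simp_all add: inner_perp[OF norm_e])
  have np: "norm p \<le> C * s" "norm q \<le> C * u"
    using sublevel_cone[OF x(1,2)] sublevel_cone[OF y(1,2)] su by (simp_all add: p_def q_def s_def u_def)
  have gx: "\<bar>g x \<bullet> v - v \<bullet> L p\<bar> \<le> \<eta> * (C * s) * norm v" for v
  proof -
    have "\<bar>g x \<bullet> v - v \<bullet> L p\<bar> \<le> \<eta> * norm p * norm v"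
      using gradient_inner[OF x(1), of v] by (simp add: p_def inner_commute)
    also have "\<dots> \<le> \<eta> * (C * s) * norm v"
      using pos np by (intro mult_right_mono mult_left_mono) auto
    finally show ?thesis .
  qed
  have gy: "\<bar>g y \<bullet> v - v \<bullet> L q\<bar> \<le> \<eta> * (C * u) * norm v" for v
  proof -
    have "\<bar>g y \<bullet> v - v \<bullet> L q\<bar> \<le> \<eta> * norm q * norm v"
      using gradient_inner[OF y(1), of v] by (simp add: q_def inner_commute)
    also have "\<dots> \<le> \<eta> * (C * u) * norm v"
      using pos np by (intro mult_right_mono mult_left_mono) auto
    finally show ?thesis .
  qed
  have qpv: "(q - p) \<bullet> v = w \<bullet> v" if "e \<bullet> v = 0" for v
    using that by (simp add: w_def perp_def inner_diff_left)
  have w: "\<nu> * norm w \<le> \<eta> * C * (s + u)"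
  proof -
    have "0 \<le> (k1 + k2) * (w \<bullet> w)" using k by simp
    moreover have "g x \<bullet> w = k1 * (w \<bullet> w)" "g y \<bullet> w = - (k2 * (w \<bullet> w))"
      unfolding k(3,4) qp using qpv[OF ew(1)] by (simp_all del: minus_diff_eq)
    moreover have "w \<bullet> L w = w \<bullet> L q - w \<bullet> L p"
    proof -
      have "perp e w = w" using ew(1) by (simp add: perp_def)
      moreover have "L w = L (perp e q) - L (perp e p)" unfolding wpq a_def by (rule L.diff)
      ultimately show ?thesis
        using ew(1) unfolding inner_L[of w q] inner_L[of w p] by (simp add: inner_diff_right)
    qed
    moreover have "\<nu> * (norm w)\<^sup>2 \<le> w \<bullet> L w" by (rule coercive[OF ew(1)])
    ultimately have "\<nu> * (norm w)\<^sup>2 \<le> \<eta> * (C * s) * norm w + \<eta> * (C * u) * norm w"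
      using gx[of w] gy[of w] by (simp add: distrib_right)
    then have "norm w * (\<nu> * norm w) \<le> norm w * (\<eta> * C * (s + u))"
      by (simp add: power2_eq_square algebra_simps)
    then show ?thesis
      using pos su by (cases "norm w = 0") auto
  qed
  \<comment> \<open>Testing against \<open>e\<close> bounds the multiplier. The product with
    \<open>s + u\<close> is what matters: it offsets the factor \<open>s + u\<close> in the bound on
    \<open>w\<close>, so the final estimate depends on \<open>s\<close> alone even if
    \<open>u\<close> is much larger.\<close>
  have k1: "k1 * (s + u) \<le> (\<mu> + \<eta> * C) * s"
  proof -
    have "g x \<bullet> e = - (k1 * (s + u))"
      unfolding k(3) qp by (simp add: s_def u_def inner_commute inner_diff_left algebra_simps)
    moreover have "e \<bullet> L p = - \<mu> * s"
      using selfadjoint[of e p] by (simp add: Le s_def)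
    ultimately show ?thesis using gx[of e] norm_e by (simp add: algebra_simps)
  qed
  \<comment> \<open>Now the condition at \<open>x\<close> alone is tested against \<open>a\<close>,
    the orthogonal part of \<open>x - z\<close>.\<close>
  have "\<nu> * norm a \<le> k1 * norm w + \<eta> * C * s"
  proof -
    have "g x \<bullet> a = k1 * (w \<bullet> a)"
      unfolding k(3) qp using qpv[OF ew(2)] by simp
    also have "\<dots> \<le> k1 * (norm w * norm a)"
      using k by (intro mult_left_mono norm_cauchy_schwarz)
    finally have "g x \<bullet> a \<le> k1 * (norm w * norm a)" .
    moreover have "a \<bullet> L p = a \<bullet> L a"
      using ew(2) unfolding inner_L[of a p] by (simp add: perp_def[of e a] a_def[symmetric])
    moreover have "\<nu> * (norm a)\<^sup>2 \<le> a \<bullet> L a" by (rule coercive[OF ew(2)])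
    ultimately have "\<nu> * (norm a)\<^sup>2 \<le> k1 * (norm w * norm a) + \<eta> * (C * s) * norm a"
      using gx[of a] by simp
    then have "norm a * (\<nu> * norm a) \<le> norm a * (k1 * norm w + \<eta> * C * s)"
      by (simp add: power2_eq_square algebra_simps)
    then show ?thesis
      using pos su k by (cases "norm a = 0") auto
  qed
  then have "\<nu> * (\<nu> * norm a) \<le> \<nu> * (k1 * norm w + \<eta> * C * s)"
    using pos by (intro mult_left_mono) auto
  also have "\<dots> = k1 * (\<nu> * norm w) + \<nu> * (\<eta> * C * s)" by (simp add: algebra_simps)
  also have "\<dots> \<le> k1 * (\<eta> * C * (s + u)) + \<nu> * (\<eta> * C * s)"
    using k w by (intro add_right_mono mult_left_mono)
  also have "\<dots> = \<eta> * C * (k1 * (s + u)) + \<nu> * (\<eta> * C * s)" by simp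
  also have "\<dots> \<le> \<eta> * C * ((\<mu> + \<eta> * C) * s) + \<nu> * (\<eta> * C * s)"
    using k1 pos by (intro add_right_mono mult_left_mono) auto
  also have "\<dots> = \<eta> * (C * (\<mu> + \<eta> * C) + C * \<nu>) * s" by (simp add: algebra_simps)
  also have "\<dots> \<le> \<nu>\<^sup>2 * \<delta> * s" using su by (intro mult_right_mono delta_large) auto
  finally have "\<nu>\<^sup>2 * norm a \<le> \<nu>\<^sup>2 * (\<delta> * s)" by (simp add: power2_eq_square)
  then show ?thesis using pos by (simp add: a_def s_def p_def)
qed

text \<open>The axial component of \<open>g x\<close> is \<open>- \<mu>\<close> times the height, up
  to an error of \<open>\<eta> * C\<close> times the height, and \<open>\<eta> * C < \<mu>\<close>.
  This makes the multipliers of optimal pairs positive.\<close>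

lemma gradient_nonzero:
  assumes x: "x \<in> ball z r" "f x \<le> f z" and s: "e \<bullet> (x - z) \<noteq> 0"
  shows "g x \<noteq> 0"
proof
  assume "g x = 0"
  have "L (x - z) \<bullet> e = - \<mu> * (e \<bullet> (x - z))"
    using selfadjoint[of "x - z" e] by (simp add: Le inner_commute)
  then have "\<mu> * \<bar>e \<bullet> (x - z)\<bar> \<le> \<eta> * norm (x - z)"
    using gradient_inner[OF x(1), of e] \<open>g x = 0\<close> norm_e pos by (simp add: abs_mult)
  also have "\<dots> \<le> \<eta> * (C * \<bar>e \<bullet> (x - z)\<bar>)"
    using sublevel_cone[OF x] pos by (intro mult_left_mono) auto
  finally have "\<mu> \<le> \<eta> * C" using s by simp
  also have "\<dots> \<le> \<eta> * C\<^sup>2"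
    using pos mult_left_mono[of 1 C C] by (intro mult_left_mono) (auto simp: power2_eq_square)
  finally show False using eta_small(2) pos by linarith
qed

text \<open>Sides are recorded by the sign of the height within the fixed ball of radius
  \<open>r\<close>, so uniqueness does not refer to \<theta> or to components.\<close>

definition kkt_pair :: "real \<Rightarrow> 'a \<Rightarrow> 'a \<Rightarrow> bool" where
  "kkt_pair b x y \<longleftrightarrow>
    x \<in> ball z r \<and> 0 < e \<bullet> (x - z) \<and> f x = b \<and> y \<in> ball z r \<and> e \<bullet> (y - z) < 0 \<and> f y = b \<and>
    (\<exists>k1 k2. 0 \<le> k1 \<and> 0 \<le> k2 \<and> g x = k1 *\<^sub>R (y - x) \<and> g y = k2 *\<^sub>R (x - y))"

lemma kkt_pair_separation:
  assumes p: "kkt_pair b x y" and p': "kkt_pair b x' y'" and "b < f z" and ne: "x \<noteq> x' \<or> y \<noteq> y'"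
  shows "0 < (y - x) \<bullet> ((y' - x') - (y - x))"
proof -
  interpret neg: saddle f g L z r \<eta> "- e" \<mu> \<nu> M C \<delta> by (rule saddle_uminus)
  have cone: "norm (perp e (v - z)) \<le> \<delta> * (e \<bullet> (v - z)) \<and> norm (perp e (w - z)) \<le> \<delta> * (- e \<bullet> (w - z))"
    if "kkt_pair b v w" for v w
    using that \<open>b < f z\<close> kkt_cone[of v w] neg.kkt_cone[of w v] by (auto simp: kkt_pair_def)
  obtain k1 k2 where k: "0 \<le> k1" "0 \<le> k2" "g x = k1 *\<^sub>R (y - x)" "g y = k2 *\<^sub>R (x - y)"
    using p by (auto simp: kkt_pair_def)
  have "k1 \<noteq> 0" using gradient_nonzero[of x] p \<open>b < f z\<close> k by (auto simp: kkt_pair_def)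
  have "k2 \<noteq> 0" using gradient_nonzero[of y] p \<open>b < f z\<close> k by (auto simp: kkt_pair_def)
  \<comment> \<open>As \<open>k1\<close> is positive, \<open>g x\<close> may be replaced by
    \<open>y - x\<close> in the strict convexity of the level set.\<close>
  have 1: "(y - x) \<bullet> (x' - x) < 0" if "x \<noteq> x'"
  proof -
    have "g x \<bullet> (x' - x) < 0"
      using p p' cone[OF p] cone[OF p'] that by (intro level_chord) (auto simp: kkt_pair_def)
    then show ?thesis unfolding k inner_scaleR_left using k(1) \<open>k1 \<noteq> 0\<close> by (simp only: mult_less_0_iff) auto
  qed
  have 2: "0 < (y - x) \<bullet> (y' - y)" if "y \<noteq> y'"
  proof -
    have "g y \<bullet> (y' - y) < 0"
      using p p' cone[OF p] cone[OF p'] that by (intro neg.level_chord) (auto simp: kkt_pair_def)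
    then have "(x - y) \<bullet> (y' - y) < 0"
      unfolding k inner_scaleR_left using k(2) \<open>k2 \<noteq> 0\<close> by (simp only: mult_less_0_iff) auto
    then show ?thesis by (simp add: inner_diff_left)
  qed
  have "(y - x) \<bullet> ((y' - x') - (y - x)) = (y - x) \<bullet> (y' - y) - (y - x) \<bullet> (x' - x)"
    by (simp add: inner_diff_right)
  then show ?thesis using 1 2 ne by (cases "x = x'"; cases "y = y'") auto
qed

lemma kkt_pair_unique:
  assumes p: "kkt_pair b x y" and p': "kkt_pair b x' y'" and b: "b < f z"
  shows "x = x' \<and> y = y'"
proof (rule ccontr)
  assume "\<not> ?thesis"
  then have "0 < (y - x) \<bullet> ((y' - x') - (y - x))" "0 < (y' - x') \<bullet> ((y - x) - (y' - x'))"
    using kkt_pair_separation[OF p p' b] kkt_pair_separation[OF p' p b] by auto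
  then have "((y' - x') - (y - x)) \<bullet> ((y' - x') - (y - x)) < 0"
    by (simp add: inner_diff_left inner_diff_right inner_commute)
  then show False by (metis inner_ge_zero not_less)
qed

end

section \<open>Existence of a closest pair and identification of the components\<close>

text \<open>The sheets lie in an open ball, so compactness is used only on the half-size closed ball
  \<open>K\<close>. A pair that leaves \<open>K\<close> has, by the cone bound, a height difference
  of at least \<open>\<theta> / (2 * C)\<close>, which exceeds the distance \<open>2 * s\<close> of
  two axis points in \<open>K\<close>.\<close>

lemma (in saddle) closest_pair:
  assumes th: "0 < \<theta>" "\<theta> \<le> r" and eps: "0 < \<epsilon>" "64 * C\<^sup>2 * \<epsilon> < \<mu> * \<theta>\<^sup>2"
    and A: "A = sheet \<theta> \<epsilon>" and B: "B = saddle.sheet f z (- e) \<theta> \<epsilon>"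
  obtains x y where "x \<in> A" "y \<in> B" "\<And>x' y'. x' \<in> A \<Longrightarrow> y' \<in> B \<Longrightarrow> norm (x - y) \<le> norm (x' - y')"
proof -
  interpret neg: saddle f g L z r \<eta> "- e" \<mu> \<nu> M C \<delta> by (rule saddle_uminus)
  \<comment> \<open>Chosen so that \<open>\<mu> / 4 * s\<^sup>2 = \<epsilon>\<close>; the bound on
    \<epsilon> then says \<open>4 * C * s < \<theta>\<close>.\<close>
  define s where "s = sqrt (4 * \<epsilon> / \<mu>)"
  have s2: "s\<^sup>2 = 4 * \<epsilon> / \<mu>" "0 < s" using eps pos by (simp_all add: s_def)
  have "(4 * C * s)\<^sup>2 < \<theta>\<^sup>2"
    using eps pos by (simp add: power_mult_distrib s2 field_simps)
  then have sC: "4 * C * s < \<theta>" by (rule power_less_imp_less_base) (use th in simp)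
  have "4 * 1 * s \<le> 4 * C * s" using pos s2 by (intro mult_right_mono) auto
  then have s\<theta>: "4 * s < \<theta>" using sC by simp
  define K where "K = cball z (\<theta> / 2)"
  have comp: "compact (K \<inter> {x. f x \<le> f z - \<epsilon>} \<inter> {x. 0 \<le> v \<bullet> (x - z)})" for v
  proof -
    have "continuous_on UNIV f"
      using grad by (intro continuous_at_imp_continuous_on) (auto simp: gderiv_def intro: has_derivative_continuous)
    then have "closed {x. f x \<le> f z - \<epsilon>}" "closed {x. 0 \<le> v \<bullet> (x - z)}"
      by (intro closed_Collect_le continuous_intros; assumption)+
    then show ?thesis by (intro compact_Int_closed) (auto simp: K_def)
  qed
  \<comment> \<open>Height 0 does not occur below the saddle level, so the strict sign condition may
    be replaced by a closed one.\<close>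
  have sheet_eq: "sheet \<theta> \<epsilon> \<inter> K = K \<inter> {x. f x \<le> f z - \<epsilon>} \<inter> {x. 0 \<le> e \<bullet> (x - z)}"
    "neg.sheet \<theta> \<epsilon> \<inter> K = K \<inter> {x. f x \<le> f z - \<epsilon>} \<inter> {x. 0 \<le> - e \<bullet> (x - z)}"
  proof -
    have "x \<in> ball z r \<and> x \<in> ball z \<theta>" if "x \<in> K" for x using that th by (auto simp: K_def)
    then show "sheet \<theta> \<epsilon> \<inter> K = K \<inter> {x. f x \<le> f z - \<epsilon>} \<inter> {x. 0 \<le> e \<bullet> (x - z)}"
      "neg.sheet \<theta> \<epsilon> \<inter> K = K \<inter> {x. f x \<le> f z - \<epsilon>} \<inter> {x. 0 \<le> - e \<bullet> (x - z)}"
      using sublevel_inner_nonzero eps unfolding sheet_def neg.sheet_def by (fastforce simp: less_le)+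
  qed
  let ?P = "(A \<inter> K) \<times> (B \<inter> K)"
  have tips: "z + s *\<^sub>R e \<in> A \<inter> K" "z - s *\<^sub>R e \<in> B \<inter> K"
  proof -
    have "\<epsilon> \<le> \<mu> / 4 * s\<^sup>2" using s2 pos by simp
    then show "z + s *\<^sub>R e \<in> A \<inter> K" "z - s *\<^sub>R e \<in> B \<inter> K"
      using axis_in_sheet[of s \<theta> \<epsilon>] neg.axis_in_sheet[of s \<theta> \<epsilon>] s2 s\<theta> th norm_e
      by (auto simp: A B K_def dist_norm)
  qed
  have "compact ?P" unfolding A B sheet_eq by (intro compact_Times comp)
  moreover have "?P \<noteq> {}" using tips by blast
  moreover have "continuous_on ?P (\<lambda>w. norm (fst w - snd w))" by (intro continuous_intros)
  ultimately obtain w where w: "w \<in> ?P" "\<And>w'. w' \<in> ?P \<Longrightarrow> norm (fst w - snd w) \<le> norm (fst w' - snd w')"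
    using continuous_attains_inf[of ?P "\<lambda>w. norm (fst w - snd w)"] by blast
  have far: "2 * s \<le> norm (x - y)" if "x \<in> A" "y \<in> B" "x \<notin> K \<or> y \<notin> K" for x y
  proof -
    have x: "x \<in> ball z r" "f x \<le> f z" "0 < e \<bullet> (x - z)"
      using that(1) eps th by (auto simp: A sheet_def)
    have y: "y \<in> ball z r" "f y \<le> f z" "e \<bullet> (y - z) < 0"
      using that(2) eps th by (auto simp: B neg.sheet_def)
    have nx: "norm (x - z) \<le> C * (e \<bullet> (x - z))" "norm (y - z) \<le> C * - (e \<bullet> (y - z))"
      using sublevel_cone[OF x(1,2)] sublevel_cone[OF y(1,2)] x y by simp_all
    have "norm (x - z) \<ge> \<theta> / 2 \<or> norm (y - z) \<ge> \<theta> / 2"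
      using that(3) by (auto simp: K_def dist_norm norm_minus_commute)
    moreover have "0 \<le> C * (e \<bullet> (x - z))" "0 \<le> C * - (e \<bullet> (y - z))"
      using x y pos by (auto intro!: mult_nonneg_nonneg mult_nonneg_nonpos)
    ultimately have "\<theta> / 2 \<le> C * (e \<bullet> (x - z)) + C * - (e \<bullet> (y - z))"
      using nx by linarith
    also have "\<dots> = C * (e \<bullet> (x - y))" by (simp add: inner_diff_right algebra_simps)
    finally have "C * (2 * s) \<le> C * (e \<bullet> (x - y))" using sC by simp
    then have "2 * s \<le> e \<bullet> (x - y)" using pos by simp
    then show ?thesis using abs_inner_le_norm[OF norm_e, of "x - y"] by linarith
  qed
  have tip: "norm (fst w - snd w) \<le> 2 * s"
    using w(2)[of "(z + s *\<^sub>R e, z - s *\<^sub>R e)"] tips s2 norm_e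
    by (simp add: scaleR_2[symmetric])
  have "norm (fst w - snd w) \<le> norm (x' - y')" if "x' \<in> A" "y' \<in> B" for x' y'
  proof (cases "x' \<in> K \<and> y' \<in> K")
    case True
    then show ?thesis using w(2)[of "(x', y')"] that by simp
  next
    case False
    then show ?thesis using far[OF that] tip by linarith
  qed
  then show ?thesis using that[of "fst w" "snd w"] w(1) by auto
qed

text \<open>The ball and the half-space are open, hence go into the neighbourhood \<open>U\<close>;
  the level constraint is the only one that produces a multiplier.\<close>

lemma (in saddle) closest_pair_kkt:
  assumes "\<theta> \<le> r" "0 < \<epsilon>"
    and x: "x \<in> sheet \<theta> \<epsilon>" and y: "y \<in> saddle.sheet f z (- e) \<theta> \<epsilon>"
    and min: "\<And>w. w \<in> sheet \<theta> \<epsilon> \<Longrightarrow> norm (x - y) \<le> norm (w - y)"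
  shows "f x = f z - \<epsilon> \<and> (\<exists>k\<ge>0. g x = k *\<^sub>R (y - x))"
proof (rule nearest_point_multiplier[where U = "ball z \<theta> \<inter> {x. 0 < e \<bullet> (x - z)}"])
  interpret neg: saddle f g L z r \<eta> "- e" \<mu> \<nu> M C \<delta> by (rule saddle_uminus)
  show "open (ball z \<theta> \<inter> {x. 0 < e \<bullet> (x - z)})"
    by (intro open_Int open_ball open_Collect_less continuous_intros)
  show "x \<in> ball z \<theta> \<inter> {x. 0 < e \<bullet> (x - z)}" "f x \<le> f z - \<epsilon>"
    using x by (auto simp: sheet_def)
  show "g x \<noteq> 0"
    using x assms(1,2) by (intro gradient_nonzero) (auto simp: sheet_def)
  show "x \<noteq> y" using x y by (auto simp: sheet_def neg.sheet_def)
  show "norm (x - y) \<le> norm (w - y)" if "w \<in> ball z \<theta> \<inter> {x. 0 < e \<bullet> (x - z)}" "f w \<le> f z - \<epsilon>" for w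
    using that by (intro min) (auto simp: sheet_def)
qed (rule grad)

text \<open>The sheets are path connected, and a path component with both signs of the height would,
  being connected, meet the hyperplane of height 0, which the sublevel set avoids.\<close>

lemma (in saddle) sheets_are_components:
  assumes th: "0 < \<theta>" "\<theta> \<le> r" and eps: "0 < \<epsilon>" "16 * \<epsilon> < \<mu> * \<theta>\<^sup>2"
    and A: "A = sheet \<theta> \<epsilon>" and B: "B = saddle.sheet f z (- e) \<theta> \<epsilon>"
  shows "A \<noteq> B \<and> {path_component_set ({x. f x \<le> f z - \<epsilon>} \<inter> ball z \<theta>) x | x.
    x \<in> {x. f x \<le> f z - \<epsilon>} \<inter> ball z \<theta>} = {A, B}"
proof -
  interpret neg: saddle f g L z r \<eta> "- e" \<mu> \<nu> M C \<delta> by (rule saddle_uminus)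
  let ?S = "{x. f x \<le> f z - \<epsilon>} \<inter> ball z \<theta>"
  have nz: "e \<bullet> (x - z) \<noteq> 0" if "x \<in> ?S" for x
    using that th eps by (intro sublevel_inner_nonzero) auto
  have sub: "A \<subseteq> ?S" "B \<subseteq> ?S" and un: "?S = A \<union> B" and dj: "A \<inter> B = {}"
    using nz unfolding A B sheet_def neg.sheet_def by (auto, fastforce)
  have pc: "path_connected A" "path_connected B"
    using path_connected_sheet[of \<theta> \<epsilon>] neg.path_connected_sheet[of \<theta> \<epsilon>] th eps by (auto simp: A B)
  have ne: "A \<noteq> {}" "B \<noteq> {}"
  proof -
    define s where "s = sqrt (4 * \<epsilon> / \<mu>)"
    have s2: "s\<^sup>2 = 4 * \<epsilon> / \<mu>" "0 < s" using eps pos by (simp_all add: s_def)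
    have "s\<^sup>2 < \<theta>\<^sup>2" using eps pos by (simp add: s2 field_simps)
    then have "s < \<theta>" by (rule power_less_imp_less_base) (use th in simp)
    then show "A \<noteq> {}" "B \<noteq> {}"
      using axis_in_sheet[of s \<theta> \<epsilon>] neg.axis_in_sheet[of s \<theta> \<epsilon>] s2 th pos by (auto simp: A B)
  qed
  have same_sign: "(0 < e \<bullet> (x - z)) = (0 < e \<bullet> (y - z))" if "y \<in> path_component_set ?S x" for x y
  proof (rule ccontr)
    let ?T = "path_component_set ?S x"
    assume neq: "(0 < e \<bullet> (x - z)) \<noteq> (0 < e \<bullet> (y - z))"
    have "x \<in> ?T" using that by (metis mem_Collect_eq path_component_mem(1) path_component_refl)
    have "connected ?T" by (intro path_connected_imp_connected path_connected_path_component)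
    moreover have "\<exists>a\<in>?T. \<exists>b\<in>?T. e \<bullet> a \<le> e \<bullet> z \<and> e \<bullet> z \<le> e \<bullet> b"
      using neq \<open>x \<in> ?T\<close> that by (auto simp: inner_diff_right not_less intro: less_imp_le)
    ultimately obtain w where "w \<in> ?T" "e \<bullet> w = e \<bullet> z"
      using connected_ivt_hyperplane[of ?T _ _ e "e \<bullet> z"] by blast
    then show False using nz[OF subsetD[OF path_component_subset \<open>w \<in> ?T\<close>]] by (simp add: inner_diff_right)
  qed
  have cA: "path_component_set ?S x = A" if "x \<in> A" for x
  proof
    show "A \<subseteq> path_component_set ?S x" by (rule path_component_maximal[OF that pc(1) sub(1)])
    show "path_component_set ?S x \<subseteq> A"
    proof
      fix y assume y: "y \<in> path_component_set ?S x"
      then have "y \<in> ?S" using path_component_subset by blast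
      then show "y \<in> A" using same_sign[OF y] that by (auto simp: A sheet_def)
    qed
  qed
  have cB: "path_component_set ?S x = B" if "x \<in> B" for x
  proof
    show "B \<subseteq> path_component_set ?S x" by (rule path_component_maximal[OF that pc(2) sub(2)])
    show "path_component_set ?S x \<subseteq> B"
    proof
      fix y assume y: "y \<in> path_component_set ?S x"
      then have "y \<in> ?S" using path_component_subset by blast
      then show "y \<in> B" using same_sign[OF y] nz[of y] that by (auto simp: B neg.sheet_def)
    qed
  qed
  have "{path_component_set ?S x | x. x \<in> ?S} = {A, B}"
  proof (intro set_eqI iffI)
    fix T assume "T \<in> {path_component_set ?S x | x. x \<in> ?S}"
    then obtain x where "T = path_component_set ?S x" "x \<in> A \<union> B" using un by auto
    then show "T \<in> {A, B}" using cA cB by auto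
  next
    fix T assume "T \<in> {A, B}"
    then obtain x where "x \<in> T" "x \<in> ?S" "T = path_component_set ?S x"
      using cA cB ne sub by blast
    then show "T \<in> {path_component_set ?S x | x. x \<in> ?S}" by blast
  qed
  then show ?thesis using ne dj by auto
qed

lemma (in saddle) unique_kkt_pair:
  assumes th: "0 < \<theta>" "\<theta> \<le> r" and eps: "0 < \<epsilon>" "64 * C\<^sup>2 * \<epsilon> < \<mu> * \<theta>\<^sup>2"
    and A: "A = sheet \<theta> \<epsilon>" and B: "B = saddle.sheet f z (- e) \<theta> \<epsilon>"
    and KKT: "\<And>x y. KKT x y \<longleftrightarrow> (\<exists>\<kappa>1 \<kappa>2. \<kappa>1 \<ge> 0 \<and> \<kappa>2 \<ge> 0 \<and>
      g x = \<kappa>1 *\<^sub>R (y - x) \<and> g y = \<kappa>2 *\<^sub>R (x - y)) \<and> f x = f z - \<epsilon> \<and> f y = f z - \<epsilon>"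
  shows "\<exists>xt yt. xt \<in> A \<and> yt \<in> B \<and>
    (\<forall>x\<in>A. \<forall>y\<in>B. norm (xt - yt) \<le> norm (x - y)) \<and>
    (\<forall>x\<in>A. \<forall>y\<in>B. norm (x - y) \<le> norm (xt - yt) \<longrightarrow> x = xt \<and> y = yt) \<and>
    KKT xt yt \<and> (\<forall>x\<in>A. \<forall>y\<in>B. KKT x y \<longrightarrow> x = xt \<and> y = yt)"
proof -
  interpret neg: saddle f g L z r \<eta> "- e" \<mu> \<nu> M C \<delta> by (rule saddle_uminus)
  have kkt: "KKT x y"
    if xy: "x \<in> A" "y \<in> B" and min: "\<And>x' y'. x' \<in> A \<Longrightarrow> y' \<in> B \<Longrightarrow> norm (x - y) \<le> norm (x' - y')" for x y
  proof -
    have "f x = f z - \<epsilon> \<and> (\<exists>k\<ge>0. g x = k *\<^sub>R (y - x))"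
      using th(2) eps(1) xy min unfolding A B by (intro closest_pair_kkt) auto
    moreover have "f y = f z - \<epsilon> \<and> (\<exists>k\<ge>0. g y = k *\<^sub>R (x - y))"
    proof (rule neg.closest_pair_kkt[OF th(2) eps(1)])
      show "norm (y - x) \<le> norm (w - x)" if "w \<in> neg.sheet \<theta> \<epsilon>" for w
        using min[OF xy(1), of w] that by (simp add: B norm_minus_commute)
    qed (use xy in \<open>auto simp: A B\<close>)
    ultimately show ?thesis unfolding KKT by blast
  qed
  have uniq: "x = x' \<and> y = y'" if "x \<in> A" "x' \<in> A" "y \<in> B" "y' \<in> B" "KKT x y" "KKT x' y'" for x x' y y'
    using that th eps(1)
    by (intro kkt_pair_unique[of "f z - \<epsilon>"]) (auto simp: A B sheet_def neg.sheet_def KKT kkt_pair_def)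
  obtain xt yt where t: "xt \<in> A" "yt \<in> B" "\<And>x' y'. x' \<in> A \<Longrightarrow> y' \<in> B \<Longrightarrow> norm (xt - yt) \<le> norm (x' - y')"
    using closest_pair[OF th eps A B] by blast
  \<comment> \<open>A pair at most as long as the minimal one is itself a minimizer, hence optimal,
    hence the same pair.\<close>
  have "x = xt \<and> y = yt" if "x \<in> A" "y \<in> B" "norm (x - y) \<le> norm (xt - yt)" for x y
    using that t by (intro uniq kkt) (auto intro: order_trans)
  moreover have "KKT xt yt" using t by (intro kkt)
  ultimately show ?thesis using t uniq by (intro exI[of _ xt] exI[of _ yt]) blast
qed

section \<open>From a C2 function to the constants of the saddle\<close>

text \<open>The mean value inequality for \<open>g - H z\<close>, whose derivative
  \<open>H w - H z\<close> is small near \<open>z\<close> by continuity of \<open>H\<close>.\<close>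

lemma C2_gradient_approx:
  fixes f :: "real^'n \<Rightarrow> real"
  assumes C2: "C2_with f g H" and "0 < \<eta>"
  shows "\<exists>r>0. gradient_approx f g ((*v) (H z)) z r \<eta>"
proof -
  \<comment> \<open>An entrywise bound \<open>B\<close> controls the operator norm up to the number
    of matrix entries.\<close>
  define B where "B = \<eta> / (real CARD('n) * real CARD('n))"
  have "0 < B" using \<open>0 < \<eta>\<close> by (simp add: B_def)
  moreover have "isCont H z" using C2 by (simp add: C2_with_def continuous_on_eq_continuous_at)
  ultimately obtain r where r: "0 < r" "\<And>x. dist x z < r \<Longrightarrow> dist (H x) (H z) < B"
    unfolding continuous_at_eps_delta by blast
  have "gradient_approx f g ((*v) (H z)) z r \<eta>"
  proof (rule gradient_approx.intro[OF matrix_vector_mul_bounded_linear])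
    show "GDERIV f x :> g x" for x using C2 by (simp add: C2_with_def)
    show "norm (g x - g y - H z *v (x - y)) \<le> \<eta> * norm (x - y)"
      if xy: "x \<in> ball z r" "y \<in> ball z r" for x y
    proof -
      have "norm ((g x - H z *v x) - (g y - H z *v y)) \<le> \<eta> * norm (x - y)"
      proof (rule differentiable_bound[OF convex_ball[of z r]])
        fix w assume w: "w \<in> ball z r"
        have "((\<lambda>w. g w - H z *v w) has_derivative (\<lambda>h. H w *v h - H z *v h)) (at w)"
          using C2 by (intro has_derivative_diff bounded_linear_imp_has_derivative matrix_vector_mul_bounded_linear)
            (simp add: C2_with_def)
        moreover have "(\<lambda>h. H w *v h - H z *v h) = (*v) (H w - H z)"
          by (simp add: fun_eq_iff matrix_vector_mult_diff_rdistrib)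
        ultimately show "((\<lambda>w. g w - H z *v w) has_derivative (*v) (H w - H z)) (at w within ball z r)"
          by (simp only: has_derivative_at_withinI)
        have "\<bar>(H w - H z) $ i $ j\<bar> \<le> B" for i j
        proof -
          have "\<bar>(H w - H z) $ i $ j\<bar> \<le> norm (H w - H z)"
            using component_le_norm_cart order_trans Finite_Cartesian_Product.norm_nth_le[of "H w - H z" i] by blast
          also have "\<dots> \<le> B" using r(2)[of w] w by (simp add: dist_norm norm_minus_commute less_imp_le)
          finally show ?thesis .
        qed
        from onorm_le_matrix_component[OF this]
        show "onorm ((*v) (H w - H z)) \<le> \<eta>" by (simp add: B_def)
      qed (use xy in auto)
      then show ?thesis by (simp add: matrix_vector_mult_diff_distrib algebra_simps)
    qed
  qed
  then show ?thesis using r(1) by blast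
qed

text \<open>\<open>C2_with\<close> does not demand a symmetric Hessian; symmetry is derived here,
  since the approximation holds for every positive \<eta>.\<close>

lemma C2_hessian_selfadjoint:
  fixes f :: "real^'n \<Rightarrow> real"
  assumes "C2_with f g H"
  shows "(H z *v x) \<bullet> y = x \<bullet> (H z *v y)"
  by (rule gradient_approx_selfadjoint[OF C2_gradient_approx[OF assms]])

text \<open>For fixed \<open>C\<close>, with \<delta> the function \<open>D\<close> of \<eta>, the
  remaining conditions are strict inequalities between continuous functions of \<eta> that hold at
  0, so they persist for small positive \<eta>.\<close>

lemma saddle_constants:
  fixes \<mu> \<nu> M :: real
  assumes pos: "0 < \<mu>" "0 < \<nu>" "0 \<le> M"
  obtains C \<delta> \<eta> :: real where "1 \<le> C" "0 \<le> \<delta>" "\<delta> \<le> 1" "0 < \<eta>"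
    "\<mu> + \<eta> \<le> (C - 1)\<^sup>2 * (\<nu> - \<eta>)" "4 * \<eta> \<le> \<nu>" "4 * \<eta> * C\<^sup>2 \<le> \<mu>"
    "\<eta> * (C * (\<mu> + \<eta> * C) + C * \<nu>) \<le> \<nu>\<^sup>2 * \<delta>"
    "4 * (\<nu> + \<mu>) * (M * \<delta> + 3 * \<eta>)\<^sup>2 \<le> \<nu> * \<mu>\<^sup>2"
proof -
  \<comment> \<open>At \<open>\<eta> = 0\<close> the cone condition needs
    \<open>(C - 1)\<^sup>2 * \<nu> \<ge> \<mu>\<close>; the factor 2 makes it strict.\<close>
  define C where "C = 1 + 2 * sqrt (\<mu> / \<nu>)"
  have C: "1 \<le> C" "(C - 1)\<^sup>2 = 4 * \<mu> / \<nu>"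
    using pos by (simp_all add: C_def power_mult_distrib)
  \<comment> \<open>The value of \<delta> that turns the lower bound on \<delta> into an equality;
    it tends to 0 with \<eta>.\<close>
  define D where "D \<eta> = \<eta> * (C * (\<mu> + \<eta> * C) + C * \<nu>) / \<nu>\<^sup>2" for \<eta>
  have lim0: "(h \<longlongrightarrow> h 0) (at_right 0)" if "isCont h 0" for h :: "real \<Rightarrow> real"
    using that by (simp add: isCont_def filterlim_at_split)
  have D0: "D 0 = 0" by (simp add: D_def)
  have cont: "isCont D 0" unfolding D_def using pos by (intro continuous_intros) auto
  have "\<forall>\<^sub>F \<eta> in at_right 0. \<mu> + \<eta> < (C - 1)\<^sup>2 * (\<nu> - \<eta>)"
  proof -
    have "\<forall>\<^sub>F \<eta> in at_right 0. 0 < (C - 1)\<^sup>2 * (\<nu> - \<eta>) - (\<mu> + \<eta>)"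
      by (rule order_tendstoD(1)[OF lim0]) (use pos C in \<open>auto intro!: continuous_intros\<close>)
    then show ?thesis by eventually_elim simp
  qed
  moreover have "\<forall>\<^sub>F \<eta> in at_right 0. 4 * \<eta> < \<nu>"
    by (rule order_tendstoD(2)[OF lim0]) (use pos in \<open>auto intro!: continuous_intros\<close>)
  moreover have "\<forall>\<^sub>F \<eta> in at_right 0. 4 * \<eta> * C\<^sup>2 < \<mu>"
    by (rule order_tendstoD(2)[OF lim0]) (use pos in \<open>auto intro!: continuous_intros\<close>)
  moreover have "\<forall>\<^sub>F \<eta> in at_right 0. D \<eta> < 1"
    by (rule order_tendstoD(2)[OF lim0[OF cont]]) (simp add: D0)
  moreover have "\<forall>\<^sub>F \<eta> in at_right 0. 4 * (\<nu> + \<mu>) * (M * D \<eta> + 3 * \<eta>)\<^sup>2 < \<nu> * \<mu>\<^sup>2"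
    by (rule order_tendstoD(2)[OF lim0]) (use pos in \<open>auto intro!: continuous_intros cont simp: D0\<close>)
  ultimately have "\<forall>\<^sub>F \<eta> in at_right 0. 0 < \<eta> \<and> \<mu> + \<eta> < (C - 1)\<^sup>2 * (\<nu> - \<eta>) \<and> 4 * \<eta> < \<nu> \<and>
      4 * \<eta> * C\<^sup>2 < \<mu> \<and> D \<eta> < 1 \<and> 4 * (\<nu> + \<mu>) * (M * D \<eta> + 3 * \<eta>)\<^sup>2 < \<nu> * \<mu>\<^sup>2"
    using eventually_at_right_less[of "0::real"] by eventually_elim simp
  then obtain \<eta> where \<eta>: "0 < \<eta>" "\<mu> + \<eta> < (C - 1)\<^sup>2 * (\<nu> - \<eta>)" "4 * \<eta> < \<nu>"
      "4 * \<eta> * C\<^sup>2 < \<mu>" "D \<eta> < 1" "4 * (\<nu> + \<mu>) * (M * D \<eta> + 3 * \<eta>)\<^sup>2 < \<nu> * \<mu>\<^sup>2"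
    using eventually_happens[of _ "at_right (0::real)"] by (auto simp: trivial_limit_at_right_real)
  have "0 \<le> D \<eta>" unfolding D_def using pos C \<eta>(1) by (intro divide_nonneg_nonneg mult_nonneg_nonneg add_nonneg_nonneg) auto
  then show ?thesis
    using that[of C "D \<eta>" \<eta>] C \<eta> pos by (simp add: D_def less_imp_le)
qed

theorem theorem5p6:
  fixes f :: "real^'n \<Rightarrow> real"
    and g :: "real^'n \<Rightarrow> real^'n"
    and H :: "real^'n \<Rightarrow> real^'n^'n"
    and xbar :: "real^'n" and c :: real
  assumes C2: "C2_with f g H"
    and crit: "g xbar = 0"
    and nondeg: "invertible (H xbar)"
    and index1: "morse_index (H xbar) = 1"
    and val: "f xbar = c"
  shows "\<exists>\<theta>0>0. \<forall>\<theta>. 0 < \<theta> \<and> \<theta> < \<theta>0 \<longrightarrow>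
          (\<exists>\<epsilon>0>0. \<forall>\<epsilon>. 0 < \<epsilon> \<and> \<epsilon> < \<epsilon>0 \<longrightarrow>
            (let S = {x. f x \<le> c - \<epsilon>} \<inter> ball xbar \<theta>;
                 KKT = (\<lambda>x y. (\<exists>\<kappa>1 \<kappa>2. \<kappa>1 \<ge> 0 \<and> \<kappa>2 \<ge> 0 \<and>
                          g x = \<kappa>1 *\<^sub>R (y - x) \<and> g y = \<kappa>2 *\<^sub>R (x - y)) \<and>
                          f x = c - \<epsilon> \<and> f y = c - \<epsilon>)
             in \<exists>A B. A \<noteq> B \<and> {path_component_set S x | x. x \<in> S} = {A, B} \<and>
                 (\<exists>xt yt. xt \<in> A \<and> yt \<in> B \<and>
                    (\<forall>x\<in>A. \<forall>y\<in>B. norm (xt - yt) \<le> norm (x - y)) \<and>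
                    (\<forall>x\<in>A. \<forall>y\<in>B. norm (x - y) \<le> norm (xt - yt) \<longrightarrow> x = xt \<and> y = yt) \<and>
                    KKT xt yt \<and>
                    (\<forall>x\<in>A. \<forall>y\<in>B. KKT x y \<longrightarrow> x = xt \<and> y = yt))))"
proof -
  let ?L = "(*v) (H xbar)"
  note sym = C2_hessian_selfadjoint[OF C2, of xbar]
  obtain e \<mu> \<nu> where e: "norm e = 1" "0 < \<mu>" "0 < \<nu>" "H xbar *v e = - \<mu> *\<^sub>R e"
    "\<And>v. e \<bullet> v = 0 \<Longrightarrow> \<nu> * (norm v)\<^sup>2 \<le> v \<bullet> (H xbar *v v)"
    using morse_index_1_splitting[OF sym nondeg index1] by blast
  define M where "M = onorm ?L"
  have M: "0 \<le> M" "norm (H xbar *v v) \<le> M * norm v" for v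
    unfolding M_def by (simp_all add: onorm_pos_le onorm matrix_vector_mul_bounded_linear)
  obtain C \<delta> \<eta> where const: "1 \<le> C" "0 \<le> \<delta>" "\<delta> \<le> 1" "0 < \<eta>"
    "\<mu> + \<eta> \<le> (C - 1)\<^sup>2 * (\<nu> - \<eta>)" "4 * \<eta> \<le> \<nu>" "4 * \<eta> * C\<^sup>2 \<le> \<mu>"
    "\<eta> * (C * (\<mu> + \<eta> * C) + C * \<nu>) \<le> \<nu>\<^sup>2 * \<delta>"
    "4 * (\<nu> + \<mu>) * (M * \<delta> + 3 * \<eta>)\<^sup>2 \<le> \<nu> * \<mu>\<^sup>2"
    using saddle_constants[OF e(2,3) M(1)] by blast
  obtain r where r: "0 < r" "gradient_approx f g ?L xbar r \<eta>"
    using C2_gradient_approx[OF C2 const(4)] by blast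
  interpret saddle f g ?L xbar r \<eta> e \<mu> \<nu> M C \<delta>
    by (intro saddle.intro saddle_axioms.intro)
      (fact r crit e sym M const less_imp_le[OF const(4)])+
  show ?thesis
  proof (rule exI[of _ r], intro conjI allI impI \<open>0 < r\<close>)
    fix \<theta> assume th: "0 < \<theta> \<and> \<theta> < r"
    \<comment> \<open>The bound required by \<open>closest_pair\<close>; as
      \<open>C \<ge> 1\<close>, it also implies the one for the components.\<close>
    define \<epsilon>0 where "\<epsilon>0 = \<mu> * \<theta>\<^sup>2 / (64 * C\<^sup>2)"
    show "\<exists>\<epsilon>0>0. \<forall>\<epsilon>. 0 < \<epsilon> \<and> \<epsilon> < \<epsilon>0 \<longrightarrow>
            (let S = {x. f x \<le> c - \<epsilon>} \<inter> ball xbar \<theta>;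
                 KKT = (\<lambda>x y. (\<exists>\<kappa>1 \<kappa>2. \<kappa>1 \<ge> 0 \<and> \<kappa>2 \<ge> 0 \<and>
                          g x = \<kappa>1 *\<^sub>R (y - x) \<and> g y = \<kappa>2 *\<^sub>R (x - y)) \<and>
                          f x = c - \<epsilon> \<and> f y = c - \<epsilon>)
             in \<exists>A B. A \<noteq> B \<and> {path_component_set S x | x. x \<in> S} = {A, B} \<and>
                 (\<exists>xt yt. xt \<in> A \<and> yt \<in> B \<and>
                    (\<forall>x\<in>A. \<forall>y\<in>B. norm (xt - yt) \<le> norm (x - y)) \<and>
                    (\<forall>x\<in>A. \<forall>y\<in>B. norm (x - y) \<le> norm (xt - yt) \<longrightarrow> x = xt \<and> y = yt) \<and>
                    KKT xt yt \<and>
                    (\<forall>x\<in>A. \<forall>y\<in>B. KKT x y \<longrightarrow> x = xt \<and> y = yt)))"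
    proof (rule exI[of _ \<epsilon>0], intro conjI allI impI)
      show "0 < \<epsilon>0" using th const(1) e(2) by (simp add: \<epsilon>0_def)
      fix \<epsilon> assume eps: "0 < \<epsilon> \<and> \<epsilon> < \<epsilon>0"
      have eps64: "64 * C\<^sup>2 * \<epsilon> < \<mu> * \<theta>\<^sup>2"
        using eps const(1) by (simp add: \<epsilon>0_def field_simps)
      have "1 \<le> C\<^sup>2" using const(1) by (simp add: one_le_power)
      then have "16 * \<epsilon> \<le> 64 * C\<^sup>2 * \<epsilon>" using eps by (intro mult_right_mono) auto
      then have eps16: "16 * \<epsilon> < \<mu> * \<theta>\<^sup>2" using eps64 by linarith
      have t: "0 < \<theta>" "\<theta> \<le> r" "0 < \<epsilon>" using th eps by auto
      show "let S = {x. f x \<le> c - \<epsilon>} \<inter> ball xbar \<theta>;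
                 KKT = (\<lambda>x y. (\<exists>\<kappa>1 \<kappa>2. \<kappa>1 \<ge> 0 \<and> \<kappa>2 \<ge> 0 \<and>
                          g x = \<kappa>1 *\<^sub>R (y - x) \<and> g y = \<kappa>2 *\<^sub>R (x - y)) \<and>
                          f x = c - \<epsilon> \<and> f y = c - \<epsilon>)
             in \<exists>A B. A \<noteq> B \<and> {path_component_set S x | x. x \<in> S} = {A, B} \<and>
                 (\<exists>xt yt. xt \<in> A \<and> yt \<in> B \<and>
                    (\<forall>x\<in>A. \<forall>y\<in>B. norm (xt - yt) \<le> norm (x - y)) \<and>
                    (\<forall>x\<in>A. \<forall>y\<in>B. norm (x - y) \<le> norm (xt - yt) \<longrightarrow> x = xt \<and> y = yt) \<and>
                    KKT xt yt \<and>
                    (\<forall>x\<in>A. \<forall>y\<in>B. KKT x y \<longrightarrow> x = xt \<and> y = yt))"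
        unfolding Let_def val[symmetric]
        using sheets_are_components[OF t eps16 refl refl]
          unique_kkt_pair[OF t eps64 refl refl refl]
        by (intro exI[of _ "sheet \<theta> \<epsilon>"] exI[of _ "saddle.sheet f xbar (- e) \<theta> \<epsilon>"]) (elim conjE, intro conjI)
    qed
  qed
qed

end
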